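(* Let $T$ be an $n$-branch piecewise linear expanding map with essential branch number $r_T$. Then the number of Lyapunov inflections of $T$ is less than or equal to $$\frac{r_T(r_T-1)(r_T+4)}{6}.$$
   Context: An $n$-branch piecewise linear expanding map is a map $T: X=\bigcup_{i=1}^n X_i\to[0,1]$, where $X_1,\dots,X_n\subset[0,1]$ are closed intervals with pairwise disjoint interiors, each $T|_{X_i}$ is affine and maps $X_i$ onto $[0,1]$, and $|T'|=x_i:=|X_i|^{-1}>1$ on $X_i$ (the numbers $x_i$ are called the slopes; ambiguities at common endpoints are irrelevant). Indices are arranged so that $1<x_1\le x_2\le\cdots\le x_n$; slopes may coincide. The essential branch number $r_T=\#\{x_i: 1\le i\le n\}$ is the number of distinct slopes. The repeller is $\Lambda=\bigcap_{k\ge 0}T^{-k}(X)$. The Lyapunov exponent at $x\in\Lambda$ is $\lambda(x)=\lim_{m\to\infty}\frac1m\log|(T^m)'(x)|$ when the limit exists. The Lyapunov spectrum is $L(\alpha)=\dim_H\{x\in\Lambda:\lambda(x)=\alpha\}$ (Hausdorff dimension), defined for those $\alpha$ with nonempty level set; its domain is $[\log x_1,\log x_n]$. A Lyapunov inflection of $T$ is a point $\alpha\in(\log x_1,\log x_n)$ with $L''(\alpha)=0$ (so there are none if all slopes are equal). If the slopes are not all equal, put $F(t)=\sum_{i=1}^n x_i^t$. Then $\alpha(t)=F'(t)/F(t)$ is an increasing bijection from $\mathbb{R}$ onto $(\log x_1,\log x_n)$, and $L(\alpha(t))=\frac{F(t)\log F(t)}{F'(t)}-t$. *)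

theory Defs
  imports "HOL-Analysis.Analysis"
begin

section \<open>Hausdorff dimension\<close>

text \<open>
  The covering sets are required to be bounded because \<^const>\<open>diameter\<close> is a real supremum and
  carries no information for unbounded sets.  Finite covers are included, as members may be empty.
  Only exponents \<open>s > 0\<close> are meaningful here: \<open>0 powr 0 = 0\<close>, so \<open>s = 0\<close> is not counting measure.
\<close>

definition hausdorff_premeasure :: "real \<Rightarrow> real \<Rightarrow> 'a::metric_space set \<Rightarrow> ennreal" where
  "hausdorff_premeasure s \<delta> E =
     (INF U \<in> {U :: nat \<Rightarrow> 'a set. E \<subseteq> (\<Union>i. U i) \<and> (\<forall>i. bounded (U i) \<and> diameter (U i) \<le> \<delta>)}.
        (\<Sum>i. ennreal (diameter (U i) powr s)))"

definition hausdorff_measure :: "real \<Rightarrow> 'a::metric_space set \<Rightarrow> ennreal" where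
  "hausdorff_measure s E = (SUP \<delta> \<in> {0<..}. hausdorff_premeasure s \<delta> E)"

definition hausdorff_dim :: "'a::metric_space set \<Rightarrow> ennreal" where
  "hausdorff_dim E = Inf {ennreal s | s. 0 < s \<and> hausdorff_measure s E = 0}"


section \<open>Piecewise linear expanding maps\<close>

text \<open>
  The \<open>i\<close>-th interval is \<open>X\<^sub>i = {l i..u i}\<close>, for \<open>i \<in> {1..n}\<close>.
\<close>

definition pl_domain :: "nat \<Rightarrow> (nat \<Rightarrow> real) \<Rightarrow> (nat \<Rightarrow> real) \<Rightarrow> real set" where
  "pl_domain n l u = (\<Union>i\<in>{1..n}. {l i..u i})"

definition slope :: "(nat \<Rightarrow> real) \<Rightarrow> (nat \<Rightarrow> real) \<Rightarrow> nat \<Rightarrow> real" where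
  "slope l u i = 1 / (u i - l i)"

text \<open>
  A point lying in two of the intervals is a common endpoint, where the value and the slope of the
  map are ambiguous.  The function \<open>br\<close> resolves this: it selects, for each point of the domain,
  one interval containing it, and both \<open>T\<close> and \<open>|T'|\<close> are read off from that branch.
  Away from common endpoints \<open>br\<close> is uniquely determined, and at common endpoints it is arbitrary.
  Values of \<open>T\<close> and \<open>br\<close> outside the domain play no role.
\<close>

locale pl_expanding_map =
  fixes n :: nat and l u :: "nat \<Rightarrow> real" and br :: "real \<Rightarrow> nat" and T :: "real \<Rightarrow> real"
  assumes branches_nonempty: "1 \<le> n"
    and interval: "\<And>i. i \<in> {1..n} \<Longrightarrow> l i < u i \<and> {l i..u i} \<subseteq> {0..1}"
    and interiors_disjoint:
      "\<And>i j. i \<in> {1..n} \<Longrightarrow> j \<in> {1..n} \<Longrightarrow> i \<noteq> j \<Longrightarrow>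
         interior {l i..u i} \<inter> interior {l j..u j} = {}"
    and expanding: "\<And>i. i \<in> {1..n} \<Longrightarrow> 1 < slope l u i"
    and slopes_ordered:
      "\<And>i j. i \<in> {1..n} \<Longrightarrow> j \<in> {1..n} \<Longrightarrow> i \<le> j \<Longrightarrow> slope l u i \<le> slope l u j"
    and branch: "\<And>x. x \<in> pl_domain n l u \<Longrightarrow> br x \<in> {1..n} \<and> x \<in> {l (br x)..u (br x)}"
    and affine_onto:
      "\<And>i. i \<in> {1..n} \<Longrightarrow>
         \<exists>c d. (\<lambda>x. c + d * x) ` {l i..u i} = {0..1} \<and>
               (\<forall>x\<in>pl_domain n l u. br x = i \<longrightarrow> T x = c + d * x)"

definition essential_branch_number :: "nat \<Rightarrow> (nat \<Rightarrow> real) \<Rightarrow> (nat \<Rightarrow> real) \<Rightarrow> nat" where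
  "essential_branch_number n l u = card (slope l u ` {1..n})"

definition repeller :: "nat \<Rightarrow> (nat \<Rightarrow> real) \<Rightarrow> (nat \<Rightarrow> real) \<Rightarrow> (real \<Rightarrow> real) \<Rightarrow> real set" where
  "repeller n l u T = (\<Inter>k. (T ^^ k) -` pl_domain n l u)"

text \<open>
  \<open>|(T\<^sup>m)'(x)|\<close>, by the chain rule.  See \<open>DERIV_iterate\<close> below for the agreement with the actual
  derivative of \<open>T ^^ m\<close>.
\<close>

definition abs_deriv_iterate ::
    "(nat \<Rightarrow> real) \<Rightarrow> (nat \<Rightarrow> real) \<Rightarrow> (real \<Rightarrow> nat) \<Rightarrow> (real \<Rightarrow> real) \<Rightarrow> nat \<Rightarrow> real \<Rightarrow> real" where
  "abs_deriv_iterate l u br T m x = (\<Prod>k<m. slope l u (br ((T ^^ k) x)))"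

definition has_lyapunov_exponent ::
    "(nat \<Rightarrow> real) \<Rightarrow> (nat \<Rightarrow> real) \<Rightarrow> (real \<Rightarrow> nat) \<Rightarrow> (real \<Rightarrow> real) \<Rightarrow> real \<Rightarrow> real \<Rightarrow> bool" where
  "has_lyapunov_exponent l u br T x \<alpha> \<longleftrightarrow>
     (\<lambda>m. 1 / real m * ln (abs_deriv_iterate l u br T m x)) \<longlonglongrightarrow> \<alpha>"

definition lyapunov_spectrum ::
    "nat \<Rightarrow> (nat \<Rightarrow> real) \<Rightarrow> (nat \<Rightarrow> real) \<Rightarrow> (real \<Rightarrow> nat) \<Rightarrow> (real \<Rightarrow> real) \<Rightarrow> real \<Rightarrow> real" where
  "lyapunov_spectrum n l u br T \<alpha> =
     enn2real (hausdorff_dim {x \<in> repeller n l u T. has_lyapunov_exponent l u br T x \<alpha>})"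

definition lyapunov_inflections ::
    "nat \<Rightarrow> (nat \<Rightarrow> real) \<Rightarrow> (nat \<Rightarrow> real) \<Rightarrow> (real \<Rightarrow> nat) \<Rightarrow> (real \<Rightarrow> real) \<Rightarrow> real set" where
  "lyapunov_inflections n l u br T =
     {\<alpha> \<in> {ln (slope l u 1)<..<ln (slope l u n)}.
        deriv (deriv (lyapunov_spectrum n l u br T)) \<alpha> = 0}"


section \<open>Agreement of the chain-rule product with the derivative\<close>

context pl_expanding_map
begin

lemma br_eq:
  assumes "i \<in> {1..n}" "x \<in> {l i<..<u i}"
  shows "x \<in> pl_domain n l u" "br x = i"
proof -
  show x: "x \<in> pl_domain n l u"
    using assms by (force simp: pl_domain_def)
  define j where "j = br x"
  have j: "j \<in> {1..n}" "x \<in> {l j..u j}"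
    using branch[OF x] by (auto simp: j_def)
  have "j = i"
  proof (rule ccontr)
    assume "j \<noteq> i"
    have "l j < u j" using interval[OF j(1)] by simp
    then have "max (l i) (l j) < min (u i) (u j)"
      using assms(2) j(2) by auto
    then obtain y where "max (l i) (l j) < y" "y < min (u i) (u j)"
      using dense by blast
    then have "y \<in> interior {l i..u i} \<inter> interior {l j..u j}"
      by simp
    then show False
      using interiors_disjoint[OF assms(1) j(1)] \<open>j \<noteq> i\<close> by blast
  qed
  then show "br x = i" by (simp add: j_def)
qed

lemma abs_slope_affine:
  assumes "i \<in> {1..n}" "(\<lambda>x. c + d * x) ` {l i..u i} = {0..1}"
  shows "\<bar>d\<bar> = slope l u i"
proof -
  have lu: "l i < u i" using interval[OF assms(1)] by simp
  have ends: "c + d * l i \<in> {0..1}" "c + d * u i \<in> {0..1}"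
    using assms(2) lu by (metis atLeastAtMost_iff image_eqI less_imp_le order_refl)+
  obtain y z where y: "y \<in> {l i..u i}" "c + d * y = 0" and z: "z \<in> {l i..u i}" "c + d * z = 1"
    using assms(2) by (metis (no_types, lifting) atLeastAtMost_iff imageE order_refl zero_le_one)
  have "\<bar>d\<bar> * (u i - l i) = \<bar>(c + d * u i) - (c + d * l i)\<bar>"
    using lu by (simp add: abs_mult flip: right_diff_distrib)
  then have le: "\<bar>d\<bar> * (u i - l i) \<le> 1"
    using ends by (auto simp: abs_le_iff)
  have "1 = \<bar>d\<bar> * \<bar>z - y\<bar>"
    using y(2) z(2) by (simp add: algebra_simps flip: abs_mult)
  also have "\<dots> \<le> \<bar>d\<bar> * (u i - l i)"
    using y(1) z(1) by (intro mult_left_mono) auto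
  finally have "\<bar>d\<bar> * (u i - l i) = 1" using le by simp
  then show ?thesis using lu by (simp add: slope_def field_simps)
qed

lemma DERIV_T:
  assumes "i \<in> {1..n}" "x \<in> {l i<..<u i}"
  obtains D where "(T has_real_derivative D) (at x)" "\<bar>D\<bar> = slope l u (br x)"
proof -
  obtain c d where cd: "(\<lambda>x. c + d * x) ` {l i..u i} = {0..1}"
      "\<And>x. x \<in> pl_domain n l u \<Longrightarrow> br x = i \<Longrightarrow> T x = c + d * x"
    using affine_onto[OF assms(1)] by blast
  have "((\<lambda>x. c + d * x) has_real_derivative d) (at x)"
    by (auto intro!: derivative_eq_intros)
  then have "(T has_real_derivative d) (at x)"
    by (rule has_field_derivative_transform_within_open[OF _ open_greaterThanLessThan assms(2)])
       (use cd(2) br_eq[OF assms(1)] in auto)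
  then show thesis
    using that abs_slope_affine[OF assms(1) cd(1)] br_eq[OF assms] by simp
qed

lemma DERIV_iterate:
  assumes "\<And>k. k < m \<Longrightarrow> \<exists>i\<in>{1..n}. (T ^^ k) x \<in> {l i<..<u i}"
  shows "\<exists>D. ((T ^^ m) has_real_derivative D) (at x) \<and> \<bar>D\<bar> = abs_deriv_iterate l u br T m x"
  using assms
proof (induction m)
  case 0
  show ?case
    by (rule exI[of _ 1]) (auto simp: abs_deriv_iterate_def id_def intro!: derivative_eq_intros)
next
  case (Suc m)
  obtain D where D: "((T ^^ m) has_real_derivative D) (at x)"
      "\<bar>D\<bar> = abs_deriv_iterate l u br T m x"
    using Suc.IH Suc.prems less_Suc_eq by blast
  obtain i where i: "i \<in> {1..n}" "(T ^^ m) x \<in> {l i<..<u i}"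
    using Suc.prems by blast
  obtain E where E: "(T has_real_derivative E) (at ((T ^^ m) x))"
      "\<bar>E\<bar> = slope l u (br ((T ^^ m) x))"
    using DERIV_T[OF i] .
  have "((T ^^ Suc m) has_real_derivative E * D) (at x)"
    using DERIV_chain[OF E(1) D(1)] by simp
  moreover have "\<bar>E * D\<bar> = abs_deriv_iterate l u br T (Suc m) x"
    by (simp add: abs_mult D(2) E(2) abs_deriv_iterate_def)
  ultimately show ?case by blast
qed

end

end

theory Submission
  imports Defs "HOL-Probability.Probability"
begin

text \<open>
  Write \<open>P = ln F\<close> and \<open>\<alpha> = P'\<close>.  Giving branch \<open>i\<close> the weight \<open>x\<^sub>i powr t / F t\<close>, a cylinder of length
  \<open>exp (- S)\<close> and depth \<open>m\<close> has mass \<open>exp (t * S - m * P t)\<close>, and \<open>S\<close> is close to \<open>m * \<alpha> t\<close> on the level set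
  of \<open>\<alpha> t\<close>.  Comparing masses with powers of lengths gives \<open>L (\<alpha> t) = P t / \<alpha> t - t\<close>: the upper bound by
  covering with cylinders, the lower bound by the mass distribution principle and the law of
  large numbers.

  Hence \<open>L'' = (2 P P'' - P'\<^sup>2) / (P'\<^sup>3 P'')\<close> at \<open>\<alpha> t\<close>, so inflections are the zeros of
  \<open>2 P - P'\<^sup>2 / P''\<close>, whose derivative is \<open>P'\<^sup>2 P''' / P''\<^sup>2\<close>.  Now \<open>F\<^sup>3 P'''\<close> is an exponential sum whose
  exponents are sums of three log-slopes that are not all equal; there are at most
  \<open>r (r - 1) (r + 4) / 6\<close> of those, and an exponential sum has fewer zeros than terms.  Rolle's
  theorem gives back the lost one.
\<close>

section \<open>Zeros of exponential sums\<close>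

text \<open>The inflection condition \<open>2 P P'' = P'^2\<close> mixes the logarithm
  \<open>P\<close> with rational functions of exponential sums. Dividing by \<open>P''\<close>
  leaves \<open>P\<close> with a constant coefficient, so a single differentiation removes the
  logarithm, at the price of one application of Rolle. In the exponential sum that remains, a triple
  with three equal exponents has coefficient \<open>1 - 3 + 2 = 0\<close> times a cube and drops
  out. Hence the count is (r choose 3) + r (r - 1), three-element subsets plus ordered pairs
  (doubled entry, single entry), instead of the (r + 2 choose 3) multisets. On the dimension side
  there are two obstacles. Cylinders of one depth have very different lengths, so a set of diameter
  \<open>d\<close> is compared with cylinders stopped at length about \<open>d\<close>. And coding
  is ambiguous at common endpoints: every point of the repeller has an itinerary, but a sequence is
  recovered from its point only off a countable set, which is null.\<close>

text \<open>Stated for finite sets \<open>A\<close> of zeros, since finiteness of the whole zero set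
  is still to be shown. The clause that \<open>B\<close> lies below elements of \<open>A\<close>
  makes the induction work: the new critical point lies above \<open>Max A\<close>, hence outside
  \<open>B\<close>.\<close>

lemma Rolle_zeros_aux:
  fixes f f' :: "real \<Rightarrow> real"
  assumes deriv: "\<And>t. (f has_real_derivative f' t) (at t)"
    and "finite A" "A \<subseteq> {t. f t = 0}"
  shows "\<exists>B \<subseteq> {t. f' t = 0}. finite B \<and> (\<forall>b\<in>B. \<exists>a\<in>A. b < a) \<and> card A \<le> Suc (card B)"
  using assms(2,3)
proof (induction A rule: finite_linorder_max_induct)
  case empty
  show ?case by (rule exI[of _ "{}"]) simp
next
  case (insert x A)
  then obtain B where B: "B \<subseteq> {t. f' t = 0}" "finite B" "\<forall>b\<in>B. \<exists>a\<in>A. b < a" "card A \<le> Suc (card B)"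
    by auto
  show ?case
  proof (cases "A = {}")
    case True
    then show ?thesis by (intro exI[of _ "{}"]) simp
  next
    case False
    define m where "m = Max A"
    have m: "m \<in> A" "m < x" using insert False by (auto simp: m_def)
    have "f m = f x" using m insert.prems by auto
    moreover have "continuous_on {m..x} f"
      by (meson DERIV_isCont continuous_at_imp_continuous_on deriv)
    ultimately obtain z where z: "m < z" "z < x" "(\<lambda>v. f' z * v) = (\<lambda>v. 0)"
      using Rolle_deriv[OF m(2), of f "\<lambda>t v. f' t * v"] deriv
      by (auto simp: has_field_derivative_def)
    have "f' z = 0" using fun_cong[OF z(3), of 1] by simp
    moreover have "z \<notin> B"
      using B(3) z(1) insert.hyps(1) unfolding m_def
      by (meson Max_ge leD less_trans)
    ultimately show ?thesis
      using B z insert.hyps by (intro exI[of _ "insert z B"]) (auto simp: card_insert_if intro: less_trans)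
  qed
qed

lemma Rolle_card_zeros:
  fixes f f' :: "real \<Rightarrow> real"
  assumes "\<And>t. (f has_real_derivative f' t) (at t)" and fin: "finite {t. f' t = 0}"
  shows "finite {t. f t = 0}" "card {t. f t = 0} \<le> Suc (card {t. f' t = 0})"
proof -
  have "finite {t. f t = 0} \<and> card {t. f t = 0} \<le> Suc (card {t. f' t = 0})"
  proof (rule finite_if_finite_subsets_card_bdd)
    fix A assume A: "A \<subseteq> {t. f t = 0}" "finite A"
    obtain B where "B \<subseteq> {t. f' t = 0}" "card A \<le> Suc (card B)"
      using Rolle_zeros_aux[OF assms(1) A(2,1)] by blast
    then show "card A \<le> Suc (card {t. f' t = 0})"
      using card_mono[OF fin] by (meson Suc_le_mono le_trans)
  qed
  then show "finite {t. f t = 0}" "card {t. f t = 0} \<le> Suc (card {t. f' t = 0})" by auto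
qed

text \<open>Multiplying by \<open>exp (- b * t)\<close> turns one summand into a constant, which differentiation kills.\<close>

lemma exp_sum_card_zeros:
  fixes c :: "real \<Rightarrow> real"
  assumes "finite S" "\<exists>t. (\<Sum>a\<in>S. c a * exp (a * t)) \<noteq> 0"
  shows "finite {t. (\<Sum>a\<in>S. c a * exp (a * t)) = 0} \<and>
    card {t. (\<Sum>a\<in>S. c a * exp (a * t)) = 0} < card S"
  using assms
proof (induction S arbitrary: c rule: finite_induct)
  case empty
  then show ?case by simp
next
  case (insert b S)
  define g where "g t = c b + (\<Sum>a\<in>S. c a * exp ((a - b) * t))" for t
  define g' where "g' t = (\<Sum>a\<in>S. c a * (a - b) * exp (a * t))" for t
  have g: "(\<Sum>a\<in>insert b S. c a * exp (a * t)) = exp (b * t) * g t" for t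
    using insert.hyps
    by (simp add: g_def distrib_left sum_distrib_left algebra_simps flip: exp_add)
  have D: "(g has_real_derivative exp (- b * t) * g' t) (at t)" for t
    unfolding g_def
    by (auto intro!: derivative_eq_intros sum.cong
          simp: g'_def sum_distrib_left algebra_simps simp flip: exp_add)
  have zeros: "{t. (\<Sum>a\<in>insert b S. c a * exp (a * t)) = 0} = {t. g t = 0}"
    unfolding g by simp
  show ?case
  proof (cases "\<exists>t. g' t \<noteq> 0")
    case True
    then have "finite {t. exp (- b * t) * g' t = 0}" "card {t. exp (- b * t) * g' t = 0} < card S"
      using insert.IH[of "\<lambda>a. c a * (a - b)"] by (auto simp: g'_def)
    with Rolle_card_zeros[OF D] show ?thesis
      unfolding zeros using insert.hyps by simp
  next
    \<comment> \<open>The induction hypothesis needs a sum that is not identically zero. Here it is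
      zero, so \<open>g\<close> is a constant, nonzero by assumption, and has no zeros at
      all.\<close>
    case False
    then have "(g has_real_derivative 0) (at t)" for t using D[of t] by simp
    then have const: "g t = g s" for s t using DERIV_isconst_all by blast
    obtain s where "g s \<noteq> 0" using insert.prems unfolding g by auto
    then have "{t. g t = 0} = {}" using const by (metis (mono_tags) empty_Collect_eq)
    then show ?thesis unfolding zeros using insert.hyps by simp
  qed
qed

text \<open>A sum with three different entries depends only on a 3-subset; a sum with exactly two
  equal entries is given by an ordered pair. Different choices may give the same sum, hence only an
  upper bound.\<close>

lemma card_triple_sums_le:
  fixes \<Lambda> :: "real set"
  assumes "finite \<Lambda>"
  shows "real (card {a + b + c | a b c. a \<in> \<Lambda> \<and> b \<in> \<Lambda> \<and> c \<in> \<Lambda> \<and> \<not> (a = b \<and> b = c)})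
    \<le> real (card \<Lambda>) * (real (card \<Lambda>) - 1) * (real (card \<Lambda>) + 4) / 6" (is "real (card ?E) \<le> _")
proof -
  define r where "r = card \<Lambda>"
  define A where "A = (\<lambda>X. \<Sum>X) ` {X. X \<subseteq> \<Lambda> \<and> card X = 3}"
  define B where "B = (\<lambda>(a, b). 2 * a + b) ` (SIGMA a:\<Lambda>. \<Lambda> - {a})"
  have fin: "finite A" "finite B" using assms by (auto simp: A_def B_def)
  have cA: "card A \<le> r choose 3"
    unfolding A_def r_def n_subsets[OF assms, symmetric] by (rule card_image_le) (use assms in auto)
  have "card B \<le> card (SIGMA a:\<Lambda>. \<Lambda> - {a})"
    unfolding B_def by (rule card_image_le) (use assms in auto)
  also have "\<dots> = r * (r - 1)" using assms by (simp add: r_def)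
  finally have cB: "card B \<le> r * (r - 1)" .
  have "?E \<subseteq> A \<union> B"
  proof
    fix e assume "e \<in> ?E"
    then obtain a b c where e: "e = a + b + c" "a \<in> \<Lambda>" "b \<in> \<Lambda>" "c \<in> \<Lambda>" "\<not> (a = b \<and> b = c)" by auto
    have B: "2 * x + y \<in> B" if "x \<in> \<Lambda>" "y \<in> \<Lambda>" "x \<noteq> y" for x y
      using that unfolding B_def by force
    consider "a \<noteq> b" "b \<noteq> c" "a \<noteq> c" | "a = b" "b \<noteq> c" | "b = c" "a \<noteq> b" | "a = c" "b \<noteq> c"
      using e by blast
    then show "e \<in> A \<union> B"
    proof cases
      case 1
      then have "card {a, b, c} = 3" "\<Sum>{a, b, c} = e" using e by auto
      then show ?thesis unfolding A_def using e by blast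
    next
      case 2 then show ?thesis using B[of a c] e by simp
    next
      case 3 then show ?thesis using B[of b a] e by (simp add: algebra_simps)
    next
      case 4 then show ?thesis using B[of a b] e by (simp add: algebra_simps)
    qed
  qed
  then have "card ?E \<le> card (A \<union> B)" using fin by (intro card_mono) auto
  also have "\<dots> \<le> (r choose 3) + r * (r - 1)"
    using card_Un_le[of A B] cA cB by linarith
  finally have "real (card ?E) \<le> real (r choose 3) + real (r * (r - 1))" by linarith
  also have "real (r choose 3) = real r * (real r - 1) * (real r - 2) / 6"
    by (simp add: binomial_gbinomial gbinomial_prod_rev eval_nat_numeral)
  also have "real (r * (r - 1)) = real r * (real r - 1)"
    by (cases r) (auto simp: algebra_simps)
  also have "real r * (real r - 1) * (real r - 2) / 6 + real r * (real r - 1)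
      = real r * (real r - 1) * (real r + 4) / 6"
    by (simp add: field_simps)
  finally show ?thesis by (simp add: r_def)
qed

section \<open>Inflections of the spectrum\<close>

locale exponential_sum =
  fixes I :: "'i set" and \<theta> :: "'i \<Rightarrow> real"
  assumes finite_I: "finite I"
    and nonconstant: "\<exists>i\<in>I. \<exists>j\<in>I. \<theta> i \<noteq> \<theta> j"
begin

section \<open>Moments of the exponents, the pressure and its derivatives\<close>

definition F :: "nat \<Rightarrow> real \<Rightarrow> real" where
  "F k t = (\<Sum>i\<in>I. \<theta> i ^ k * exp (\<theta> i * t))"

definition pressure :: "real \<Rightarrow> real" where
  "pressure t = ln (F 0 t)"

definition \<alpha> :: "real \<Rightarrow> real" where
  "\<alpha> t = F 1 t / F 0 t"

definition V :: "real \<Rightarrow> real" where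
  "V t = (F 0 t * F 2 t - (F 1 t)\<^sup>2) / (F 0 t)\<^sup>2"

lemma DERIV_F [derivative_intros]: "(F k has_real_derivative F (Suc k) t) (at t)"
  unfolding F_def by (auto intro!: derivative_eq_intros sum.cong)

lemma I_nonempty: "I \<noteq> {}"
  using nonconstant by auto

lemma F0_pos: "F 0 t > 0"
  unfolding F_def using finite_I I_nonempty by (auto intro!: sum_pos)

text \<open>\<open>V t\<close> is the variance of \<open>\<theta>\<close> under the weights proportional to \<open>exp (\<theta> i * t)\<close>.\<close>

lemma V_pos: "V t > 0"
proof -
  have "(\<Sum>i\<in>I. (\<theta> i - \<alpha> t)\<^sup>2 * exp (\<theta> i * t)) = F 2 t - 2 * \<alpha> t * F 1 t + (\<alpha> t)\<^sup>2 * F 0 t"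
    by (simp add: F_def sum_distrib_left sum_distrib_right sum.distrib sum_subtractf power2_diff algebra_simps)
  also have "\<dots> = F 0 t * V t"
    using F0_pos[of t] by (simp add: \<alpha>_def V_def field_simps power2_eq_square)
  finally have eq: "(\<Sum>i\<in>I. (\<theta> i - \<alpha> t)\<^sup>2 * exp (\<theta> i * t)) = F 0 t * V t" .
  obtain i where "i \<in> I" "\<theta> i \<noteq> \<alpha> t" using nonconstant by metis
  then have "(\<Sum>i\<in>I. (\<theta> i - \<alpha> t)\<^sup>2 * exp (\<theta> i * t)) > 0"
    using finite_I by (intro sum_pos2[of _ i]) auto
  then show ?thesis unfolding eq using F0_pos[of t] by (simp add: zero_less_mult_iff)
qed

lemma DERIV_pressure: "(pressure has_real_derivative \<alpha> t) (at t)"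
  unfolding pressure_def using F0_pos[of t] by (auto intro!: derivative_eq_intros simp: \<alpha>_def)

lemma DERIV_\<alpha>: "(\<alpha> has_real_derivative V t) (at t)"
  unfolding \<alpha>_def using F0_pos[of t]
  by (auto intro!: derivative_eq_intros simp: V_def field_simps power2_eq_square numeral_2_eq_2)

text \<open>Third derivative of the pressure, that is, the third central moment of
  \<open>\<theta>\<close> under the weights proportional to
  \<open>exp (\<theta> i * t)\<close>.\<close>

definition W :: "real \<Rightarrow> real" where
  "W t = ((F 0 t)\<^sup>2 * F 3 t - 3 * F 0 t * F 1 t * F 2 t + 2 * F 1 t ^ 3) / (F 0 t) ^ 3"

lemma DERIV_V: "(V has_real_derivative W t) (at t)"
proof -
  have "(V has_real_derivative
     ((F 1 t * F 2 t + F 0 t * F 3 t - 2 * F 1 t * F 2 t) * (F 0 t)\<^sup>2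
        - (F 0 t * F 2 t - (F 1 t)\<^sup>2) * (2 * F 0 t * F 1 t)) / ((F 0 t)\<^sup>2)\<^sup>2) (at t)"
    unfolding V_def using F0_pos[of t]
    by (auto intro!: derivative_eq_intros simp: power2_eq_square numeral_2_eq_2 numeral_3_eq_3 algebra_simps)
  also have "((F 1 t * F 2 t + F 0 t * F 3 t - 2 * F 1 t * F 2 t) * (F 0 t)\<^sup>2
        - (F 0 t * F 2 t - (F 1 t)\<^sup>2) * (2 * F 0 t * F 1 t)) / ((F 0 t)\<^sup>2)\<^sup>2 = W t"
    using F0_pos[of t] by (simp add: W_def divide_simps) (simp add: algebra_simps power2_eq_square power3_eq_cube power4_eq_xxxx)
  finally show ?thesis .
qed

section \<open>Monotonicity and range of \<open>\<alpha>\<close>\<close>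

lemma strict_mono_\<alpha>: "strict_mono \<alpha>"
  by (rule strict_monoI, rule DERIV_pos_imp_increasing) (use DERIV_\<alpha> V_pos in blast)+

text \<open>Rescaled by \<open>exp (- \<theta> j * t)\<close>, the difference
  \<open>F 1 t - y * F 0 t\<close> tends to \<open>\<theta> j - y\<close> times the number of
  indices with maximal exponent, because all other terms decay.\<close>

lemma \<alpha>_eventually_greater:
  assumes j: "j \<in> I" "\<And>i. i \<in> I \<Longrightarrow> \<theta> i \<le> \<theta> j" and y: "y < \<theta> j"
  shows "eventually (\<lambda>t. \<alpha> t > y) at_top"
proof -
  have "((\<lambda>t. (\<theta> i - y) * exp ((\<theta> i - \<theta> j) * t)) \<longlongrightarrow> (if \<theta> i = \<theta> j then \<theta> j - y else 0)) at_top"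
    if i: "i \<in> I" for i
  proof (cases "\<theta> i = \<theta> j")
    case False
    then have "\<theta> i - \<theta> j < 0" using j(2)[OF i] by simp
    then have "((\<lambda>t. (\<theta> i - y) * exp ((\<theta> i - \<theta> j) * t)) \<longlongrightarrow> 0) at_top" by real_asymp
    then show ?thesis using False by simp
  qed auto
  then have "((\<lambda>t. \<Sum>i\<in>I. (\<theta> i - y) * exp ((\<theta> i - \<theta> j) * t)) \<longlongrightarrow>
      (\<Sum>i\<in>I. if \<theta> i = \<theta> j then \<theta> j - y else 0)) at_top"
    by (rule tendsto_sum)
  moreover have "(\<Sum>i\<in>I. if \<theta> i = \<theta> j then \<theta> j - y else 0) > 0"
    using finite_I j y by (intro sum_pos2[of _ j]) auto
  ultimately have "eventually (\<lambda>t. (\<Sum>i\<in>I. (\<theta> i - y) * exp ((\<theta> i - \<theta> j) * t)) > 0) at_top"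
    by (rule order_tendstoD)
  then show ?thesis
  proof eventually_elim
    case (elim t)
    have "exp (\<theta> j * t) * (\<Sum>i\<in>I. (\<theta> i - y) * exp ((\<theta> i - \<theta> j) * t)) = F 1 t - y * F 0 t"
      by (simp add: F_def sum_distrib_left sum_subtractf algebra_simps flip: exp_add)
    moreover have "exp (\<theta> j * t) * (\<Sum>i\<in>I. (\<theta> i - y) * exp ((\<theta> i - \<theta> j) * t)) > 0"
      using elim by simp
    ultimately show ?case using F0_pos[of t] by (simp add: \<alpha>_def field_simps)
  qed
qed

lemma \<alpha>_eventually_less:
  assumes j: "j \<in> I" "\<And>i. i \<in> I \<Longrightarrow> \<theta> j \<le> \<theta> i" and y: "\<theta> j < y"
  shows "eventually (\<lambda>t. \<alpha> t < y) at_bot"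
proof -
  interpret neg: exponential_sum I "\<lambda>i. - \<theta> i"
    using finite_I nonconstant by unfold_locales auto
  have "neg.\<alpha> t = - \<alpha> (- t)" for t
    by (simp add: neg.\<alpha>_def \<alpha>_def neg.F_def F_def sum_negf)
  moreover have "eventually (\<lambda>t. neg.\<alpha> t > - y) at_top"
    using j y by (intro neg.\<alpha>_eventually_greater) auto
  ultimately have "eventually (\<lambda>t. \<alpha> (- t) < y) at_top" by simp
  then show ?thesis
    by (simp add: at_bot_mirror eventually_filtermap)
qed

lemma \<alpha>_bounds:
  assumes "\<And>i. i \<in> I \<Longrightarrow> a \<le> \<theta> i" "\<And>i. i \<in> I \<Longrightarrow> \<theta> i \<le> b"
  shows "a \<le> \<alpha> t" "\<alpha> t \<le> b"
proof -
  have "a * F 0 t \<le> F 1 t" "F 1 t \<le> b * F 0 t"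
    unfolding F_def sum_distrib_left using assms by (auto intro!: sum_mono)
  then show "a \<le> \<alpha> t" "\<alpha> t \<le> b" using F0_pos[of t] by (auto simp: \<alpha>_def field_simps)
qed

lemma range_\<alpha>:
  assumes "i \<in> I" "j \<in> I" "\<And>k. k \<in> I \<Longrightarrow> \<theta> i \<le> \<theta> k" "\<And>k. k \<in> I \<Longrightarrow> \<theta> k \<le> \<theta> j"
  shows "range \<alpha> = {\<theta> i<..<\<theta> j}"
proof (intro equalityI subsetI)
  fix y assume "y \<in> range \<alpha>"
  then obtain t where t: "y = \<alpha> t" by auto
  \<comment> \<open>\<open>\<alpha>_bounds\<close> gives weak inequalities only; comparing with
    neighbouring parameters makes them strict.\<close>
  have "\<alpha> (t - 1) < y" "y < \<alpha> (t + 1)" using strict_mono_\<alpha> by (auto simp: t strict_mono_def)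
  with \<alpha>_bounds[OF assms(3,4)] show "y \<in> {\<theta> i<..<\<theta> j}"
    by (meson greaterThanLessThan_iff le_less_trans less_le_trans)
next
  fix y assume "y \<in> {\<theta> i<..<\<theta> j}"
  then have y: "\<theta> i < y" "y < \<theta> j" by auto
  obtain s where s: "\<alpha> s < y"
    using \<alpha>_eventually_less[OF assms(1,3) y(1)] by (meson eventually_at_bot_linorder order_refl)
  obtain t where t: "\<alpha> t > y"
    using \<alpha>_eventually_greater[OF assms(2,4) y(2)] by (meson eventually_at_top_linorder order_refl)
  have "s \<le> t" using s t strict_mono_\<alpha> by (meson leI less_asym less_trans strict_mono_less)
  then have "\<exists>x\<ge>s. x \<le> t \<and> \<alpha> x = y"
    using s t by (intro IVT) (auto intro: DERIV_isCont[OF DERIV_\<alpha>])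
  then show "y \<in> range \<alpha>" by auto
qed

text \<open>\<open>F 0 t ^ 3 * W t\<close> is a sum over index triples; grouping the triples by the
  value of their exponent sum gives an exponential sum with distinct exponents. The
  \<open>Suc\<close> is the zero that Rolle will cost later.\<close>

lemma W_card_zeros:
  "finite {t. W t = 0} \<and>
   Suc (card {t. W t = 0}) \<le> card {a + b + c | a b c. a \<in> \<theta> ` I \<and> b \<in> \<theta> ` I \<and> c \<in> \<theta> ` I \<and> \<not> (a = b \<and> b = c)}"
proof -
  define D where "D = {p \<in> I \<times> I \<times> I. \<not> (\<theta> (fst p) = \<theta> (fst (snd p)) \<and> \<theta> (fst (snd p)) = \<theta> (snd (snd p)))}"
  define e where "e = (\<lambda>(i, j, k). \<theta> i + \<theta> j + \<theta> k)"
  \<comment> \<open>The powers of \<open>\<theta>\<close> are placed according to the factor order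
    in \<open>F 0 (F 0 F 3)\<close>, \<open>F 0 (F 1 F 2)\<close> and \<open>F 1 (F 1 F 1)\<close>,
    without symmetrizing over the triple.\<close>
  define c where "c = (\<lambda>(i, j, k). \<theta> k ^ 3 - 3 * (\<theta> j * \<theta> k ^ 2) + 2 * (\<theta> i * \<theta> j * \<theta> k))"
  have finD: "finite D" using finite_I by (auto simp: D_def)
  have triple: "(\<Sum>i\<in>I. f i) * ((\<Sum>i\<in>I. g i) * (\<Sum>i\<in>I. h i)) = (\<Sum>(i, j, k)\<in>I \<times> I \<times> I. f i * (g j * h k))"
    for f g h :: "'i \<Rightarrow> real"
    by (simp add: sum_product sum.cartesian_product split_def)
  have W: "F 0 t ^ 3 * W t = (\<Sum>a\<in>e ` D. (\<Sum>p\<in>{p\<in>D. e p = a}. c p) * exp (a * t))" for t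
  proof -
    have "F 0 t ^ 3 * W t = F 0 t * (F 0 t * F 3 t) - 3 * (F 0 t * (F 1 t * F 2 t)) + 2 * (F 1 t * (F 1 t * F 1 t))"
      using F0_pos[of t] by (simp add: W_def power2_eq_square power3_eq_cube)
    also have "\<dots> = (\<Sum>p\<in>I \<times> I \<times> I. c p * exp (e p * t))"
      unfolding F_def triple
      by (simp add: sum_distrib_left split_def flip: sum.distrib sum_subtractf)
         (auto intro!: sum.cong simp: c_def e_def exp_add algebra_simps)
    \<comment> \<open>On a triple with three equal exponents \<open>c\<close> is
      \<open>\<theta> ^ 3 - 3 * \<theta> ^ 3 + 2 * \<theta> ^ 3 = 0\<close>.\<close>
    also have "\<dots> = (\<Sum>p\<in>D. c p * exp (e p * t))"
      using finite_I by (intro sum.mono_neutral_right)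
        (auto simp: D_def c_def power2_eq_square power3_eq_cube)
    also have "\<dots> = (\<Sum>a\<in>e ` D. \<Sum>p\<in>{p\<in>D. e p = a}. c p * exp (e p * t))"
      by (rule sum.image_gen[OF finD])
    also have "\<dots> = (\<Sum>a\<in>e ` D. (\<Sum>p\<in>{p\<in>D. e p = a}. c p) * exp (a * t))"
      by (simp add: sum_distrib_right)
    finally show ?thesis .
  qed
  have F0: "0 \<noteq> F 0 t" for t using F0_pos[of t] by simp
  \<comment> \<open>If \<open>W\<close> vanished identically, \<open>\<alpha>\<close> would be
    affine with slope \<open>V 0 > 0\<close>, but it is bounded by the largest exponent.\<close>
  have "\<exists>t. W t \<noteq> 0"
  proof (rule ccontr)
    assume "\<nexists>t. W t \<noteq> 0"
    then have "(V has_real_derivative 0) (at t)" for t using DERIV_V[of t] by simp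
    then have V: "V t = V 0" for t using DERIV_isconst_all by blast
    have "((\<lambda>t. \<alpha> t - V 0 * t) has_real_derivative 0) (at t)" for t
      using DERIV_\<alpha>[of t] V[of t] by (auto intro!: derivative_eq_intros)
    then have lin: "\<alpha> t = \<alpha> 0 + V 0 * t" for t
      using DERIV_isconst_all[of "\<lambda>t. \<alpha> t - V 0 * t" t 0] by (simp add: algebra_simps)
    define b where "b = Max (\<theta> ` I)"
    have "\<alpha> t \<le> b" for t
      by (rule \<alpha>_bounds(2)[of "Min (\<theta> ` I)"]) (auto simp: b_def finite_I)
    \<comment> \<open>At this parameter the affine formula gives the value
      \<open>b + 1\<close>.\<close>
    from this[of "(b - \<alpha> 0 + 1) / V 0"] show False
      using V_pos[of 0] unfolding lin[of "(b - \<alpha> 0 + 1) / V 0"] by simp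
  qed
  then obtain s where "W s \<noteq> 0" by blast
  then have "F 0 s ^ 3 * W s \<noteq> 0" using F0_pos[of s] by simp
  then have "finite {t. F 0 t ^ 3 * W t = 0} \<and> card {t. F 0 t ^ 3 * W t = 0} < card (e ` D)"
    unfolding W using finD by (intro exp_sum_card_zeros) blast+
  moreover have "{t. F 0 t ^ 3 * W t = 0} = {t. W t = 0}"
    using F0[THEN not_sym] by simp
  moreover have "e ` D = {a + b + c | a b c. a \<in> \<theta> ` I \<and> b \<in> \<theta> ` I \<and> c \<in> \<theta> ` I \<and> \<not> (a = b \<and> b = c)}"
  proof (intro equalityI subsetI)
    fix x assume "x \<in> {a + b + c | a b c. a \<in> \<theta> ` I \<and> b \<in> \<theta> ` I \<and> c \<in> \<theta> ` I \<and> \<not> (a = b \<and> b = c)}"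
    then obtain i j k where "i \<in> I" "j \<in> I" "k \<in> I" "\<not> (\<theta> i = \<theta> j \<and> \<theta> j = \<theta> k)" "x = e (i, j, k)"
      by (auto simp: e_def)
    then show "x \<in> e ` D" unfolding D_def by (intro image_eqI[of _ _ "(i, j, k)"]) auto
  next
    fix x assume "x \<in> e ` D"
    then obtain i j k where "i \<in> I" "j \<in> I" "k \<in> I" "\<not> (\<theta> i = \<theta> j \<and> \<theta> j = \<theta> k)"
        "x = \<theta> i + \<theta> j + \<theta> k"
      by (auto simp: D_def e_def)
    then show "x \<in> {a + b + c | a b c. a \<in> \<theta> ` I \<and> b \<in> \<theta> ` I \<and> c \<in> \<theta> ` I \<and> \<not> (a = b \<and> b = c)}"
      by blast
  qed
  ultimately show ?thesis by (simp add: Suc_le_eq)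
qed

lemma inflection_parameters:
  assumes pos: "\<And>t. \<alpha> t > 0"
  shows "finite {t. 2 * pressure t * V t = (\<alpha> t)\<^sup>2}" (is "finite ?Z")
    and "real (card {t. 2 * pressure t * V t = (\<alpha> t)\<^sup>2})
      \<le> real (card (\<theta> ` I)) * (real (card (\<theta> ` I)) - 1) * (real (card (\<theta> ` I)) + 4) / 6"
proof -
  define h where "h t = 2 * pressure t - (\<alpha> t)\<^sup>2 / V t" for t
  have V0: "V t \<noteq> 0" for t using V_pos[of t] by simp
  have Z: "?Z = {t. h t = 0}" using V0 by (auto simp: h_def field_simps)
  have D: "(h has_real_derivative (\<alpha> t)\<^sup>2 * W t / (V t)\<^sup>2) (at t)" for t
    unfolding h_def using V0[of t]
    by (auto intro!: derivative_eq_intros DERIV_pressure DERIV_\<alpha> DERIV_V simp: field_simps power2_eq_square)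
  \<comment> \<open>Positivity of \<open>\<alpha>\<close> keeps the factor
    \<open>(\<alpha> t)\<^sup>2\<close> from adding zeros of its own.\<close>
  have h': "{t. (\<alpha> t)\<^sup>2 * W t / (V t)\<^sup>2 = 0} = {t. W t = 0}"
    using V0 pos[THEN less_imp_neq, THEN not_sym] by simp
  note * = Rolle_card_zeros[OF D, unfolded h'] W_card_zeros
  show "finite ?Z" using * Z by simp
  have "card ?Z \<le> card {a + b + c | a b c. a \<in> \<theta> ` I \<and> b \<in> \<theta> ` I \<and> c \<in> \<theta> ` I \<and> \<not> (a = b \<and> b = c)}"
    using * Z by simp
  with card_triple_sums_le[of "\<theta> ` I"] finite_I
  show "real (card ?Z) \<le> real (card (\<theta> ` I)) * (real (card (\<theta> ` I)) - 1) * (real (card (\<theta> ` I)) + 4) / 6"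
    by (meson finite_imageI of_nat_le_iff order_trans)
qed

text \<open>The spectrum is known only along the parametrization, so it is differentiated as
  \<open>g\<close> composed with the inverse of \<open>\<alpha>\<close>. The interval between
  \<open>\<alpha> (t - 1)\<close> and \<open>\<alpha> (t + 1)\<close> is a neighbourhood of
  \<open>\<alpha> t\<close> inside the range, on which this composition agrees with
  \<open>f\<close>.\<close>

lemma DERIV_via_\<alpha>:
  assumes f: "\<And>s. f (\<alpha> s) = g s" and g: "(g has_real_derivative D) (at t)"
  shows "(f has_real_derivative D / V t) (at (\<alpha> t))"
proof -
  define inv\<alpha> where "inv\<alpha> = the_inv \<alpha>"
  have inj: "inj \<alpha>" by (rule strict_mono_imp_inj_on[OF strict_mono_\<alpha>])
  have inv: "inv\<alpha> (\<alpha> s) = s" for s by (simp add: inv\<alpha>_def the_inv_f_f inj)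
  have ran: "\<exists>s. y = \<alpha> s" if "\<alpha> (t - 1) < y" "y < \<alpha> (t + 1)" for y
    using IVT[of \<alpha> "t - 1" y "t + 1"] that by (auto intro: DERIV_isCont[OF DERIV_\<alpha>])
  have \<alpha>inv: "\<alpha> (inv\<alpha> y) = y" if "\<alpha> (t - 1) < y" "y < \<alpha> (t + 1)" for y
    using ran[OF that] inv by auto
  have t: "\<alpha> (t - 1) < \<alpha> t" "\<alpha> t < \<alpha> (t + 1)" using strict_mono_\<alpha> by (auto simp: strict_mono_def)
  have "isCont inv\<alpha> (\<alpha> t)"
    by (rule isCont_inverse_function[of 1]) (auto simp: inv intro: DERIV_isCont[OF DERIV_\<alpha>])
  then have "(inv\<alpha> has_real_derivative inverse (V t)) (at (\<alpha> t))"
    using DERIV_\<alpha>[of t] V_pos[of t] \<alpha>inv t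
    by (intro DERIV_inverse_function[where f = \<alpha> and a = "\<alpha> (t - 1)" and b = "\<alpha> (t + 1)"])
       (auto simp: inv)
  with g have "((\<lambda>y. g (inv\<alpha> y)) has_real_derivative D * inverse (V t)) (at (\<alpha> t))"
    using DERIV_chain[of g D inv\<alpha> "\<alpha> t"] by (simp add: inv o_def)
  then show ?thesis
    using t has_field_derivative_transform_within_open[of "\<lambda>y. g (inv\<alpha> y)" _ "\<alpha> t" "{\<alpha> (t - 1)<..<\<alpha> (t + 1)}" f] ran
    by (fastforce simp: divide_inverse f inv)
qed

lemma deriv2_spectrum:
  assumes L: "\<And>t. L (\<alpha> t) = pressure t / \<alpha> t - t" and pos: "\<And>t. \<alpha> t > 0"
  shows "deriv (deriv L) (\<alpha> t) = (2 * pressure t * V t - (\<alpha> t)\<^sup>2) / (\<alpha> t ^ 3 * V t)"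
proof -
  have a0: "\<alpha> t \<noteq> 0" and V0: "V t \<noteq> 0" for t using pos[of t] V_pos[of t] by auto
  have "((\<lambda>t. pressure t / \<alpha> t - t) has_real_derivative - pressure t * V t / (\<alpha> t)\<^sup>2) (at t)" for t
    using a0[of t]
    by (auto intro!: derivative_eq_intros DERIV_pressure DERIV_\<alpha> simp: field_simps power2_eq_square)
  then have d: "(L has_real_derivative - pressure t * V t / (\<alpha> t)\<^sup>2 / V t) (at (\<alpha> t))" for t
    by (rule DERIV_via_\<alpha>[where f = L and g = "\<lambda>t. pressure t / \<alpha> t - t", OF L])
  \<comment> \<open>The factor \<open>V t\<close> cancels, so the second differentiation does not
    bring in the derivative of \<open>V\<close>.\<close>
  have d1: "deriv L (\<alpha> t) = - pressure t / (\<alpha> t)\<^sup>2" for t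
    using DERIV_imp_deriv[OF d[of t]] V0[of t] by simp
  have "((\<lambda>t. - pressure t / (\<alpha> t)\<^sup>2) has_real_derivative
      (2 * pressure t * V t - (\<alpha> t)\<^sup>2) / \<alpha> t ^ 3) (at t)"
    using a0[of t]
    by (auto intro!: derivative_eq_intros DERIV_pressure DERIV_\<alpha> simp: field_simps power2_eq_square power3_eq_cube)
  from DERIV_via_\<alpha>[where f = "deriv L", OF d1 this] show ?thesis
    by (simp add: DERIV_imp_deriv)
qed

lemma card_inflections:
  assumes "\<And>t. L (\<alpha> t) = pressure t / \<alpha> t - t" and pos: "\<And>t. \<alpha> t > 0"
  shows "finite {a \<in> range \<alpha>. deriv (deriv L) a = 0}"
    and "real (card {a \<in> range \<alpha>. deriv (deriv L) a = 0})
      \<le> real (card (\<theta> ` I)) * (real (card (\<theta> ` I)) - 1) * (real (card (\<theta> ` I)) + 4) / 6"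
proof -
  have "\<alpha> t \<noteq> 0" and "V t \<noteq> 0" for t using pos[of t] V_pos[of t] by auto
  then have eq: "{a \<in> range \<alpha>. deriv (deriv L) a = 0} = \<alpha> ` {t. 2 * pressure t * V t = (\<alpha> t)\<^sup>2}"
    by (auto simp: deriv2_spectrum[OF assms])
  show "finite {a \<in> range \<alpha>. deriv (deriv L) a = 0}"
    unfolding eq using inflection_parameters(1)[OF pos] by simp
  show "real (card {a \<in> range \<alpha>. deriv (deriv L) a = 0})
      \<le> real (card (\<theta> ` I)) * (real (card (\<theta> ` I)) - 1) * (real (card (\<theta> ` I)) + 4) / 6"
    unfolding eq
    using inflection_parameters[OF pos] card_image_le[OF inflection_parameters(1)[OF pos], of \<alpha>]
    by linarith
qed

end

section \<open>Hausdorff measure and the law of large numbers\<close>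

text \<open>The dimension depends on the Hausdorff measures only through their null sets, so this
  form replaces suprema and infima in \<open>ennreal\<close> from here on.\<close>

lemma hausdorff_measure_eq_0_iff:
  "hausdorff_measure s E = 0 \<longleftrightarrow>
     (\<forall>\<delta>>0. \<forall>\<epsilon>>0. \<exists>U::nat \<Rightarrow> 'a::metric_space set. E \<subseteq> (\<Union>i. U i) \<and>
        (\<forall>i. bounded (U i) \<and> diameter (U i) \<le> \<delta>) \<and>
        (\<Sum>i. ennreal (diameter (U i) powr s)) < ennreal \<epsilon>)"
    (is "_ \<longleftrightarrow> (\<forall>\<delta>>0. \<forall>\<epsilon>>0. ?P \<delta> \<epsilon>)")
proof -
  have meas: "hausdorff_measure s E = 0 \<longleftrightarrow> (\<forall>\<delta>>0. hausdorff_premeasure s \<delta> E = 0)"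
    unfolding hausdorff_measure_def le_zero_eq[symmetric] SUP_le_iff by auto
  have pre: "hausdorff_premeasure s \<delta> E = 0 \<longleftrightarrow> (\<forall>\<epsilon>>0. ?P \<delta> \<epsilon>)" for \<delta>
  proof
    assume 0: "hausdorff_premeasure s \<delta> E = 0"
    show "\<forall>\<epsilon>>0. ?P \<delta> \<epsilon>"
    proof (intro allI impI)
      fix \<epsilon> :: real assume "\<epsilon> > 0"
      then have "hausdorff_premeasure s \<delta> E < ennreal \<epsilon>" by (simp add: 0)
      then show "?P \<delta> \<epsilon>" unfolding hausdorff_premeasure_def INF_less_iff by auto
    qed
  next
    assume P: "\<forall>\<epsilon>>0. ?P \<delta> \<epsilon>"
    have le: "hausdorff_premeasure s \<delta> E \<le> 0 + ennreal \<epsilon>" if "\<epsilon> > 0" for \<epsilon>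
    proof -
      obtain U :: "nat \<Rightarrow> 'a set" where U: "E \<subseteq> (\<Union>i. U i)" "\<forall>i. bounded (U i) \<and> diameter (U i) \<le> \<delta>"
        "(\<Sum>i. ennreal (diameter (U i) powr s)) < ennreal \<epsilon>"
        using P \<open>\<epsilon> > 0\<close> by blast
      then have "hausdorff_premeasure s \<delta> E \<le> (\<Sum>i. ennreal (diameter (U i) powr s))"
        unfolding hausdorff_premeasure_def by (intro INF_lower) auto
      with U(3) show ?thesis by simp
    qed
    have "hausdorff_premeasure s \<delta> E \<le> 0" by (rule ennreal_le_epsilon, rule le, assumption)
    then show "hausdorff_premeasure s \<delta> E = 0" by simp
  qed
  show ?thesis unfolding meas pre ..
qed

lemma hausdorff_measure_eq_0_UN:
  fixes A :: "nat \<Rightarrow> 'a::metric_space set"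
  assumes "\<And>n. hausdorff_measure s (A n) = 0"
  shows "hausdorff_measure s (\<Union>n. A n) = 0"
  unfolding hausdorff_measure_eq_0_iff
proof (intro allI impI)
  fix \<delta> \<epsilon> :: real assume "\<delta> > 0" "\<epsilon> > 0"
  \<comment> \<open>The shares add up to \<open>\<epsilon> / 2\<close>, which leaves room for the
    strict inequality.\<close>
  then have "\<exists>U. A n \<subseteq> (\<Union>i. U i) \<and> (\<forall>i::nat. bounded (U i) \<and> diameter (U i) \<le> \<delta>) \<and>
      (\<Sum>i. ennreal (diameter (U i) powr s)) < ennreal (\<epsilon> / 2 * (1 / 2) ^ Suc n)" for n
    using assms[of n] by (simp add: hausdorff_measure_eq_0_iff)
  then obtain U where U: "\<And>n. A n \<subseteq> (\<Union>i::nat. U n i)" "\<And>n i. bounded (U n i)"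
      "\<And>n i. diameter (U n i) \<le> \<delta>"
      "\<And>n. (\<Sum>i. ennreal (diameter (U n i) powr s)) < ennreal (\<epsilon> / 2 * (1 / 2) ^ Suc n)"
    by metis
  define W where "W k = (case prod_decode k of (n, i) \<Rightarrow> U n i)" for k
  have W: "ennreal (diameter (W k) powr s) = (\<lambda>(n, i). ennreal (diameter (U n i) powr s)) (prod_decode k)" for k
    by (simp add: W_def split: prod.split)
  have "(\<Sum>k. ennreal (diameter (W k) powr s)) = (\<Sum>n. \<Sum>i. ennreal (diameter (U n i) powr s))"
    unfolding W by (rule suminf_ennreal_2dimen) simp
  also have "\<dots> \<le> (\<Sum>n. ennreal (\<epsilon> / 2 * (1 / 2) ^ Suc n))"
    by (intro suminf_le less_imp_le[OF U(4)]) auto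
  also have "\<dots> = ennreal (\<epsilon> / 2)"
    using sums_mult[OF power_half_series, of "\<epsilon> / 2"] \<open>\<epsilon> > 0\<close>
    by (intro suminf_ennreal_eq) auto
  also have "\<dots> < ennreal \<epsilon>" using \<open>\<epsilon> > 0\<close> by (simp add: ennreal_less_iff)
  finally have sum: "(\<Sum>k. ennreal (diameter (W k) powr s)) < ennreal \<epsilon>" .
  have "(\<Union>n. A n) \<subseteq> (\<Union>k. W k)"
  proof
    fix x assume "x \<in> (\<Union>n. A n)"
    then obtain n i where "x \<in> U n i" using U(1) by blast
    then have "x \<in> W (prod_encode (n, i))" by (simp add: W_def)
    then show "x \<in> (\<Union>k. W k)" by blast
  qed
  with sum show "\<exists>W. (\<Union>n. A n) \<subseteq> (\<Union>i. W i) \<and> (\<forall>i::nat. bounded (W i) \<and> diameter (W i) \<le> \<delta>) \<and>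
      (\<Sum>i. ennreal (diameter (W i) powr s)) < ennreal \<epsilon>"
    using U(2,3) by (intro exI[of _ W]) (auto simp: W_def split: prod.split)
qed

lemma hausdorff_measure_eq_0_mono:
  assumes "hausdorff_measure s B = 0" "A \<subseteq> B"
  shows "hausdorff_measure s A = 0"
  using assms unfolding hausdorff_measure_eq_0_iff by (meson order_trans)

lemma hausdorff_measure_eq_0_finite_cover:
  fixes E :: "'a::metric_space set"
  assumes "\<And>\<delta> \<epsilon>. \<delta> > 0 \<Longrightarrow> \<epsilon> > 0 \<Longrightarrow> \<exists>(K :: 'k set) U. finite K \<and> E \<subseteq> (\<Union>k\<in>K. U k) \<and>
    (\<forall>k\<in>K. bounded (U k) \<and> diameter (U k) \<le> \<delta>) \<and> (\<Sum>k\<in>K. diameter (U k) powr s) < \<epsilon>"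
  shows "hausdorff_measure s E = 0"
  unfolding hausdorff_measure_eq_0_iff
proof (intro allI impI)
  fix \<delta> \<epsilon> :: real assume pos: "\<delta> > 0" "\<epsilon> > 0"
  then obtain K :: "'k set" and U where U: "finite K" "E \<subseteq> (\<Union>k\<in>K. U k)"
      "\<And>k. k \<in> K \<Longrightarrow> bounded (U k)" "\<And>k. k \<in> K \<Longrightarrow> diameter (U k) \<le> \<delta>"
      "(\<Sum>k\<in>K. diameter (U k) powr s) < \<epsilon>"
    using assms by metis
  obtain h where h: "bij_betw h {0..<card K} K"
    using ex_bij_betw_nat_finite[OF U(1)] by blast
  \<comment> \<open>Padding with empty sets is free: their diameter is 0 and
    \<open>0 powr s = 0\<close>.\<close>
  define W where "W i = (if i < card K then U (h i) else {})" for i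
  have hK: "h i \<in> K" if "i < card K" for i using h that by (auto simp: bij_betw_def)
  have "(\<Sum>i. ennreal (diameter (W i) powr s)) = (\<Sum>i\<in>{0..<card K}. ennreal (diameter (W i) powr s))"
    by (rule suminf_finite) (auto simp: W_def)
  also have "\<dots> = (\<Sum>i\<in>{0..<card K}. ennreal (diameter (U (h i)) powr s))"
    by (simp add: W_def)
  also have "\<dots> = (\<Sum>k\<in>K. ennreal (diameter (U k) powr s))"
    by (rule sum.reindex_bij_betw[OF h])
  also have "\<dots> = ennreal (\<Sum>k\<in>K. diameter (U k) powr s)" by (rule sum_ennreal) simp
  also have "\<dots> < ennreal \<epsilon>" using U(5) pos by (simp add: ennreal_less_iff sum_nonneg)
  finally have "(\<Sum>i. ennreal (diameter (W i) powr s)) < ennreal \<epsilon>" .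
  moreover have "E \<subseteq> (\<Union>i. W i)"
  proof
    fix x assume "x \<in> E"
    then obtain k where k: "k \<in> K" "x \<in> U k" using U(2) by blast
    then obtain i where "i < card K" "k = h i" using h by (force simp: bij_betw_def)
    then have "x \<in> W i" using k by (simp add: W_def)
    then show "x \<in> (\<Union>i. W i)" by blast
  qed
  ultimately show "\<exists>W. E \<subseteq> (\<Union>i. W i) \<and> (\<forall>i::nat. bounded (W i) \<and> diameter (W i) \<le> \<delta>) \<and>
      (\<Sum>i. ennreal (diameter (W i) powr s)) < ennreal \<epsilon>"
    using U(3,4) hK pos by (intro exI[of _ W]) (auto simp: W_def)
qed

text \<open>Singletons have diameter 0, and \<open>0 powr s = 0\<close> for every real
  \<open>s\<close>, so even \<open>s = 0\<close> is covered.\<close>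

lemma hausdorff_measure_countable:
  fixes B :: "'a::metric_space set"
  assumes "countable B"
  shows "hausdorff_measure s B = 0"
  unfolding hausdorff_measure_eq_0_iff
proof (intro allI impI)
  fix \<delta> \<epsilon> :: real assume "\<delta> > 0" "\<epsilon> > 0"
  have "B \<subseteq> (\<Union>i. {from_nat_into B i})"
    using from_nat_into_surj[OF assms] by fastforce
  then show "\<exists>U. B \<subseteq> (\<Union>i. U i) \<and> (\<forall>i::nat. bounded (U i) \<and> diameter (U i) \<le> \<delta>) \<and>
      (\<Sum>i. ennreal (diameter (U i) powr s)) < ennreal \<epsilon>"
    using \<open>\<delta> > 0\<close> \<open>\<epsilon> > 0\<close> by (intro exI[of _ "\<lambda>i. {from_nat_into B i}"]) auto
qed

text \<open>The measure stays on the space of codes and \<open>f\<close> is the coding map. Instead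
  of pushing the measure forward, the part of \<open>G\<close> lying over \<open>U\<close> is
  enclosed in a measurable set \<open>A\<close>. The estimate is in terms of a bound
  \<open>d > 0\<close> for the diameter, so that it also says something about sets of diameter
  0.\<close>

lemma mass_distribution_principle:
  fixes f :: "'b \<Rightarrow> 'a::metric_space"
  assumes "s > 0" "\<delta> > 0" "C \<ge> 0" and G: "G \<in> sets M" "emeasure M G \<noteq> 0"
    and cover: "\<And>U d. bounded U \<Longrightarrow> diameter U \<le> d \<Longrightarrow> 0 < d \<Longrightarrow> d \<le> \<delta> \<Longrightarrow>
      \<exists>A\<in>sets M. G \<inter> f -` U \<subseteq> A \<and> emeasure M A \<le> ennreal (C * d powr s)"
  shows "hausdorff_measure s (f ` G) \<noteq> 0"
proof
  assume 0: "hausdorff_measure s (f ` G) = 0"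
  have le: "emeasure M G \<le> 0 + ennreal \<epsilon>" if \<epsilon>: "\<epsilon> > 0" for \<epsilon>
  proof -
    \<comment> \<open>Chosen so that the cover contributes at most \<open>\<epsilon> / 2\<close>;
      the \<open>+ 1\<close> allows \<open>C = 0\<close>.\<close>
    define \<eta> where "\<eta> = \<epsilon> / (2 * (C + 1))"
    have \<eta>: "\<eta> > 0" "C * \<eta> \<le> \<epsilon> / 2" using \<epsilon> \<open>C \<ge> 0\<close> by (auto simp: \<eta>_def field_simps)
    obtain U :: "nat \<Rightarrow> 'a set" where U: "f ` G \<subseteq> (\<Union>i. U i)" "\<And>i. bounded (U i)" "\<And>i. diameter (U i) \<le> \<delta>"
        "(\<Sum>i. ennreal (diameter (U i) powr s)) < ennreal \<eta>"
      using 0 \<eta> \<open>\<delta> > 0\<close> unfolding hausdorff_measure_eq_0_iff by metis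
    have "\<exists>A\<in>sets M. G \<inter> f -` U i \<subseteq> A \<and>
        emeasure M A \<le> ennreal (C * diameter (U i) powr s) + ennreal (\<epsilon> / 2 * (1 / 2) ^ Suc i)" for i
    proof (cases "diameter (U i) > 0")
      case True
      then obtain A where A: "A \<in> sets M" "G \<inter> f -` U i \<subseteq> A" "emeasure M A \<le> ennreal (C * diameter (U i) powr s)"
        using cover[OF U(2) order_refl _ U(3)] by blast
      then show ?thesis by (intro bexI[of _ A]) (auto intro: add_increasing2)
    next
      \<comment> \<open>A set of diameter 0 adds nothing to the cover sum, but its mass must still
        be bounded. \<open>d\<close> is taken so small that \<open>C * d powr s\<close> stays within
        the \<open>i\<close>-th share of the other \<open>\<epsilon> / 2\<close>.\<close>
      case False
      then have diam: "diameter (U i) = 0" using diameter_ge_0[OF U(2)] by (simp add: order_antisym)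
      define q where "q = \<epsilon> / 2 * (1 / 2) ^ Suc i / (C + 1)"
      define d where "d = min \<delta> (q powr (1 / s))"
      have q: "q > 0" using \<epsilon> \<open>C \<ge> 0\<close> by (simp add: q_def)
      then have d: "0 < d" "d \<le> \<delta>" using \<open>\<delta> > 0\<close> by (auto simp: d_def)
      have "d powr s \<le> (q powr (1 / s)) powr s"
        using d \<open>s > 0\<close> by (intro powr_mono2) (auto simp: d_def)
      also have "\<dots> = q" using q \<open>s > 0\<close> by (simp add: powr_powr)
      finally have "C * d powr s \<le> C * q" using \<open>C \<ge> 0\<close> by (rule mult_left_mono)
      also have "\<dots> \<le> (C + 1) * q" using q by simp
      also have "\<dots> = \<epsilon> / 2 * (1 / 2) ^ Suc i"
        using \<open>C \<ge> 0\<close> by (simp only: q_def times_divide_eq_right nonzero_mult_div_cancel_left)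
      finally have "C * d powr s \<le> \<epsilon> / 2 * (1 / 2) ^ Suc i" .
      moreover obtain A where "A \<in> sets M" "G \<inter> f -` U i \<subseteq> A" "emeasure M A \<le> ennreal (C * d powr s)"
        using cover[OF U(2)[of i] _ d] diam d by auto
      ultimately have "A \<in> sets M" "G \<inter> f -` U i \<subseteq> A" "emeasure M A \<le> ennreal (\<epsilon> / 2 * (1 / 2) ^ Suc i)"
        by (blast intro: order_trans ennreal_leI)+
      then show ?thesis using diam \<open>s > 0\<close>
        by (intro bexI[of _ A]) simp_all
    qed
    then obtain A where A: "\<And>i. A i \<in> sets M" "\<And>i. G \<inter> f -` U i \<subseteq> A i"
        "\<And>i. emeasure M (A i) \<le> ennreal (C * diameter (U i) powr s) + ennreal (\<epsilon> / 2 * (1 / 2) ^ Suc i)"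
      by metis
    have "G \<subseteq> (\<Union>i. A i)" using U(1) A(2) by blast
    then have "emeasure M G \<le> emeasure M (\<Union>i. A i)"
      using A(1) by (intro emeasure_mono) auto
    also have "\<dots> \<le> (\<Sum>i. emeasure M (A i))"
      using A(1) by (intro emeasure_subadditive_countably) auto
    also have "\<dots> \<le> (\<Sum>i. ennreal (C * diameter (U i) powr s) + ennreal (\<epsilon> / 2 * (1 / 2) ^ Suc i))"
      by (intro suminf_le A(3)) auto
    also have "\<dots> = (\<Sum>i. ennreal C * ennreal (diameter (U i) powr s)) + (\<Sum>i. ennreal (\<epsilon> / 2 * (1 / 2) ^ Suc i))"
      by (subst suminf_add[symmetric]) (auto simp: ennreal_mult' \<open>C \<ge> 0\<close>)
    also have "(\<Sum>i. ennreal C * ennreal (diameter (U i) powr s)) = ennreal C * (\<Sum>i. ennreal (diameter (U i) powr s))"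
      by simp
    also have "(\<Sum>i. ennreal (\<epsilon> / 2 * (1 / 2) ^ Suc i)) = ennreal (\<epsilon> / 2)"
      using sums_mult[OF power_half_series, of "\<epsilon> / 2"] \<epsilon> by (intro suminf_ennreal_eq) auto
    also have "ennreal C * (\<Sum>i. ennreal (diameter (U i) powr s)) \<le> ennreal C * ennreal \<eta>"
      using U(4) by (intro mult_left_mono) auto
    also have "\<dots> \<le> ennreal (\<epsilon> / 2)"
      using \<eta> \<open>C \<ge> 0\<close> by (subst ennreal_mult'[symmetric]) (auto intro: ennreal_leI)
    finally show ?thesis using \<epsilon> by (simp flip: ennreal_plus)
  qed
  have "emeasure M G \<le> 0" by (rule ennreal_le_epsilon, rule le, assumption)
  with G(2) show False by simp
qed

text \<open>Boundedness gives Hoeffding tails that decay geometrically in \<open>m\<close>, hence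
  are summable; Borel-Cantelli then settles each fixed tolerance, and countably many tolerances
  suffice.\<close>

lemma SLLN_bounded:
  fixes g :: "'a \<Rightarrow> real"
  assumes "prob_space M" and g[measurable]: "g \<in> borel_measurable M"
    and bounds: "\<And>x. x \<in> space M \<Longrightarrow> g x \<in> {a..b}"
  shows "AE \<omega> in PiM (UNIV :: nat set) (\<lambda>_. M).
    (\<lambda>m. (\<Sum>k<m. g (\<omega> k)) / real m) \<longlonglongrightarrow> (\<integral>x. g x \<partial>M)"
proof -
  interpret M: prob_space M by fact
  interpret product_prob_space "\<lambda>_. M" "UNIV :: nat set" by unfold_locales
  let ?P = "PiM (UNIV :: nat set) (\<lambda>_. M)"
  let ?\<mu> = "\<integral>x. g x \<partial>M"
  \<comment> \<open>Hoeffding's exponent divides by the squared interval length, so the interval is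
    enlarged to a nondegenerate one, which covers constant \<open>g\<close>.\<close>
  define b' where "b' = max b (a + 1)"
  have bounds': "g x \<in> {a..b'}" if "x \<in> space M" for x
    using bounds[OF that] by (auto simp: b'_def)
  have ab: "a < b'" by (simp add: b'_def)
  have "P.indep_vars (\<lambda>_. M) (\<lambda>k \<omega>. \<omega> k) (UNIV :: nat set)"
    by (subst P.indep_vars_iff_distr_eq_PiM) (auto simp: PiM_component restrict_UNIV distr_id2)
  then have indep: "P.indep_vars (\<lambda>_. borel) (\<lambda>k \<omega>. g (\<omega> k)) (UNIV :: nat set)"
    by (rule P.indep_vars_compose2) simp
  have dist: "distr ?P borel (\<lambda>\<omega>. g (\<omega> k)) = distr M borel g" for k
  proof -
    have "distr ?P borel (\<lambda>\<omega>. g (\<omega> k)) = distr (distr ?P M (\<lambda>\<omega>. \<omega> k)) borel g"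
      by (subst distr_distr) (auto simp: o_def)
    then show ?thesis by (simp add: PiM_component)
  qed
  have tail: "P.prob {\<omega> \<in> space ?P. \<epsilon> \<le> \<bar>(\<Sum>k<m. g (\<omega> k)) / real m - ?\<mu>\<bar>}
      \<le> 2 * exp (- 2 * \<epsilon>\<^sup>2 / (b' - a)\<^sup>2) ^ m" if "\<epsilon> > 0" "m > 0" for \<epsilon> m
  proof -
    have E: "(\<integral>\<omega>. g (\<omega> k) \<partial>?P) = ?\<mu>" for k
    proof -
      have "(\<integral>\<omega>. g (\<omega> k) \<partial>?P) = (\<integral>y. y \<partial>distr ?P borel (\<lambda>\<omega>. g (\<omega> k)))"
        by (subst integral_distr) auto
      also have "\<dots> = (\<integral>y. y \<partial>distr M borel g)" by (simp only: dist)
      finally show ?thesis by (subst (asm) integral_distr) auto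
    qed
    interpret H: Hoeffding_ineq_iid ?P "{..<m}" "\<lambda>k \<omega>. g (\<omega> k)" "\<lambda>\<omega>. g (\<omega> 0)" a b' ?\<mu>
    proof (unfold_locales)
      show "P.indep_vars (\<lambda>_. borel) (\<lambda>k \<omega>. g (\<omega> k)) {..<m}"
        by (rule P.indep_vars_subset[OF indep]) simp
      show "AE \<omega> in ?P. g (\<omega> 0) \<in> {a..b'}"
        using bounds' by (intro AE_I2) (auto simp: space_PiM)
      show "?\<mu> \<equiv> P.expectation (\<lambda>\<omega>. g (\<omega> 0))" by (simp add: E)
    qed (auto simp: dist)
    have "P.prob {\<omega> \<in> space ?P. \<epsilon> \<le> \<bar>(\<Sum>k<m. g (\<omega> k)) / real m - ?\<mu>\<bar>}
      \<le> 2 * exp (- 2 * real m * \<epsilon>\<^sup>2 / (b' - a)\<^sup>2)"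
      using H.Hoeffding_ineq_abs_ge'[of \<epsilon>] that ab by (auto simp: lessThan_empty_iff)
    also have "exp (- 2 * real m * \<epsilon>\<^sup>2 / (b' - a)\<^sup>2) = exp (- 2 * \<epsilon>\<^sup>2 / (b' - a)\<^sup>2) ^ m"
      by (simp add: exp_of_nat_mult[symmetric] algebra_simps)
    finally show ?thesis .
  qed
  have ev: "AE \<omega> in ?P. eventually (\<lambda>m. \<bar>(\<Sum>k<m. g (\<omega> k)) / real m - ?\<mu>\<bar> < \<epsilon>) sequentially"
    if \<epsilon>: "\<epsilon> > 0" for \<epsilon>
  proof -
    \<comment> \<open>Shifted by one because the tail bound requires a positive number of
      summands.\<close>
    define A where "A m = {\<omega> \<in> space ?P. \<epsilon> \<le> \<bar>(\<Sum>k<Suc m. g (\<omega> k)) / real (Suc m) - ?\<mu>\<bar>}" for m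
    have [measurable]: "A m \<in> sets ?P" for m unfolding A_def by measurable
    have sm: "summable (\<lambda>m. measure ?P (A m))"
    proof (rule summable_comparison_test')
      have "- 2 * \<epsilon>\<^sup>2 / (b' - a)\<^sup>2 < 0" using \<epsilon> ab by (simp add: divide_neg_pos)
      then have "exp (- 2 * \<epsilon>\<^sup>2 / (b' - a)\<^sup>2) < 1" by simp
      then show "summable (\<lambda>m. 2 * exp (- 2 * \<epsilon>\<^sup>2 / (b' - a)\<^sup>2) * exp (- 2 * \<epsilon>\<^sup>2 / (b' - a)\<^sup>2) ^ m)"
        by (intro summable_mult summable_geometric) simp
      show "norm (measure ?P (A m)) \<le> 2 * exp (- 2 * \<epsilon>\<^sup>2 / (b' - a)\<^sup>2) * exp (- 2 * \<epsilon>\<^sup>2 / (b' - a)\<^sup>2) ^ m"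
        if "m \<ge> 0" for m
        using tail[OF \<epsilon>, of "Suc m"] by (simp add: A_def mult_ac)
    qed
    have "AE \<omega> in ?P. eventually (\<lambda>m. \<omega> \<in> space ?P - A m) sequentially"
      by (rule borel_cantelli_AE1[OF _ _ sm]) (auto simp: P.emeasure_eq_measure)
    then show ?thesis
    proof (eventually_elim)
      case (elim \<omega>)
      then have "eventually (\<lambda>m. \<bar>(\<Sum>k<Suc m. g (\<omega> k)) / real (Suc m) - ?\<mu>\<bar> < \<epsilon>) sequentially"
        by (rule eventually_mono) (auto simp: A_def)
      then show ?case by (rule eventually_sequentially_Suc[THEN iffD1])
    qed
  qed
  have "AE \<omega> in ?P. \<forall>j::nat. eventually (\<lambda>m. \<bar>(\<Sum>k<m. g (\<omega> k)) / real m - ?\<mu>\<bar> < 1 / real (Suc j)) sequentially"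
    unfolding AE_all_countable by (intro allI ev) simp
  then show ?thesis
  proof eventually_elim
    case (elim \<omega>)
    show ?case
    proof (rule tendstoI)
      fix e :: real assume "e > 0"
      then obtain j where "1 / real (Suc j) < e" using nat_approx_posE by metis
      moreover have "eventually (\<lambda>m. \<bar>(\<Sum>k<m. g (\<omega> k)) / real m - ?\<mu>\<bar> < 1 / real (Suc j)) sequentially"
        using elim by blast
      ultimately show "eventually (\<lambda>m. dist ((\<Sum>k<m. g (\<omega> k)) / real m) ?\<mu> < e) sequentially"
        by (auto elim!: eventually_mono simp: dist_real_def)
    qed
  qed
qed

section \<open>Symbolic coding of the repeller\<close>

lemma affine_image_open_interval:
  fixes c d :: real
  assumes "d \<noteq> 0"
  shows "(\<lambda>y. c + d * y) ` {0<..<1} = {min c (c + d)<..<max c (c + d)}"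
proof (intro equalityI subsetI)
  fix x assume "x \<in> (\<lambda>y. c + d * y) ` {0<..<1}"
  then obtain y where "0 < y" "y < 1" "x = c + d * y" by auto
  then show "x \<in> {min c (c + d)<..<max c (c + d)}"
    using assms by (cases "d > 0") (auto simp: min_def max_def mult_less_0_iff zero_less_mult_iff)
next
  fix x assume x: "x \<in> {min c (c + d)<..<max c (c + d)}"
  then have "(x - c) / d \<in> {0<..<1}"
    using assms by (cases "d > 0") (auto simp: min_def max_def field_simps split: if_splits)
  then show "x \<in> (\<lambda>y. c + d * y) ` {0<..<1}"
    using assms by (intro image_eqI[of _ _ "(x - c) / d"]) auto
qed

text \<open>Applied with \<open>b = s + t\<close>, whose sign is arbitrary; this is why the
  deviation is controlled on both sides and \<open>\<bar>b\<bar>\<close> appears.\<close>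

lemma deviation_bound:
  fixes b :: real
  assumes "\<bar>x - real m * a\<bar> \<le> real m * \<epsilon>" "\<bar>b\<bar> * \<epsilon> \<le> \<kappa>"
  shows "real m * (b * a - \<kappa>) \<le> b * x" "b * x \<le> real m * (b * a + \<kappa>)"
proof -
  have "\<bar>b * x - real m * (b * a)\<bar> = \<bar>b\<bar> * \<bar>x - real m * a\<bar>"
    by (simp add: abs_mult[symmetric] algebra_simps)
  also have "\<dots> \<le> \<bar>b\<bar> * (real m * \<epsilon>)" using assms(1) by (rule mult_left_mono) simp
  also have "\<dots> = real m * (\<bar>b\<bar> * \<epsilon>)" by simp
  also have "\<dots> \<le> real m * \<kappa>" using assms(2) by (rule mult_left_mono) simp
  finally show "real m * (b * a - \<kappa>) \<le> b * x" "b * x \<le> real m * (b * a + \<kappa>)"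
    by (auto simp: algebra_simps abs_le_iff)
qed

lemma average_deviation:
  assumes "m > 0" "\<bar>x / real m - a\<bar> < \<epsilon>"
  shows "\<bar>x - real m * a\<bar> \<le> real m * \<epsilon>"
proof -
  have "x - real m * a = real m * (x / real m - a)" using assms(1) by (simp add: field_simps)
  then have "\<bar>x - real m * a\<bar> = real m * \<bar>x / real m - a\<bar>" by (simp only: abs_mult abs_of_nat)
  with assms show ?thesis by (simp add: mult_left_mono)
qed

lemma exp_decay: "c > 0 \<Longrightarrow> (\<lambda>m. exp (- (real m * c))) \<longlonglongrightarrow> 0"
  by real_asymp

text \<open>Inverse branches are affine on the whole line, so they are unambiguous at common
  endpoints. \<open>\<phi>_T\<close> is the direction that holds on the entire domain;
  \<open>T (\<phi> i y) = y\<close> can fail at an endpoint where \<open>br\<close> selects the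
  neighbouring interval.\<close>

locale pl_inverse_branches = pl_expanding_map +
  fixes \<phi> :: "nat \<Rightarrow> real \<Rightarrow> real"
  assumes \<phi>_affine: "\<And>i. i \<in> {1..n} \<Longrightarrow> \<exists>c d. \<bar>d\<bar> = 1 / slope l u i \<and> (\<forall>y. \<phi> i y = c + d * y)"
    and \<phi>_image: "\<And>i. i \<in> {1..n} \<Longrightarrow> \<phi> i ` {0..1} = {l i..u i}"
    and \<phi>_T: "\<And>x. x \<in> pl_domain n l u \<Longrightarrow> \<phi> (br x) (T x) = x"
begin

section \<open>Cylinders and their lengths\<close>

definition \<theta> :: "nat \<Rightarrow> real" where
  "\<theta> i = ln (slope l u i)"

definition S :: "nat \<Rightarrow> (nat \<Rightarrow> nat) \<Rightarrow> real" where
  "S m \<omega> = (\<Sum>k<m. \<theta> (\<omega> k))"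

text \<open>The composite of \<open>\<phi> (\<omega> 0)\<close>, ...,
  \<open>\<phi> (\<omega> (m - 1))\<close> with the last symbol applied first, so that longer words
  give nested images.\<close>

primrec cyl_map :: "nat \<Rightarrow> (nat \<Rightarrow> nat) \<Rightarrow> real \<Rightarrow> real" where
  "cyl_map 0 \<omega> y = y"
| "cyl_map (Suc m) \<omega> y = cyl_map m \<omega> (\<phi> (\<omega> m) y)"

lemma domain_subset: "pl_domain n l u \<subseteq> {0..1}"
  using interval unfolding pl_domain_def by blast

lemma \<theta>_pos: "i \<in> {1..n} \<Longrightarrow> \<theta> i > 0"
  using expanding[of i] by (simp add: \<theta>_def)

lemma exp_\<theta>: "i \<in> {1..n} \<Longrightarrow> exp (\<theta> i) = slope l u i"
  using expanding[of i] by (simp add: \<theta>_def)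

lemma \<theta>_mono: "i \<in> {1..n} \<Longrightarrow> j \<in> {1..n} \<Longrightarrow> i \<le> j \<Longrightarrow> \<theta> i \<le> \<theta> j"
  using slopes_ordered[of i j] expanding[of i] expanding[of j] by (simp add: \<theta>_def)

lemma S_Suc: "S (Suc m) \<omega> = S m \<omega> + \<theta> (\<omega> m)"
  by (simp add: S_def)

lemma S_cong: "(\<And>k. k < m \<Longrightarrow> \<omega> k = \<omega>' k) \<Longrightarrow> S m \<omega> = S m \<omega>'"
  by (simp add: S_def)

lemma S_bounds:
  assumes "\<forall>k<m. \<omega> k \<in> {1..n}"
  shows "real m * \<theta> 1 \<le> S m \<omega>" "S m \<omega> \<le> real m * \<theta> n"
proof -
  have "\<theta> 1 \<le> \<theta> (\<omega> k)" "\<theta> (\<omega> k) \<le> \<theta> n" if "k < m" for k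
    using assms that by (auto intro!: \<theta>_mono)
  then show "real m * \<theta> 1 \<le> S m \<omega>" "S m \<omega> \<le> real m * \<theta> n"
    using sum_bounded_below[of "{..<m}" "\<theta> 1" "\<lambda>k. \<theta> (\<omega> k)"]
      sum_bounded_above[of "{..<m}" "\<lambda>k. \<theta> (\<omega> k)" "\<theta> n"]
    by (auto simp: S_def)
qed

lemma \<phi>_interior:
  assumes i: "i \<in> {1..n}" and y: "y \<in> {0<..<1}"
  shows "\<phi> i y \<in> {l i<..<u i}"
proof -
  obtain c d where cd: "\<bar>d\<bar> = 1 / slope l u i" "\<And>y. \<phi> i y = c + d * y"
    using \<phi>_affine[OF i] by blast
  have d: "d \<noteq> 0" using cd(1) expanding[OF i] by auto
  have "\<phi> i 0 \<in> {l i..u i}" "\<phi> i 1 \<in> {l i..u i}" unfolding \<phi>_image[OF i, symmetric] by auto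
  then have "{min c (c + d)<..<max c (c + d)} \<subseteq> {l i<..<u i}" using cd(2) by auto
  moreover have "\<phi> i y \<in> {min c (c + d)<..<max c (c + d)}"
    unfolding affine_image_open_interval[OF d, symmetric] cd(2) using y by (rule imageI)
  ultimately show ?thesis by blast
qed

lemma \<phi>_inj:
  assumes "i \<in> {1..n}" "\<phi> i y = \<phi> i z"
  shows "y = z"
  using \<phi>_affine[OF assms(1)] assms(2) expanding[OF assms(1)] by force

lemma \<phi>_coding:
  assumes "i \<in> {1..n}" "y \<in> {0<..<1}"
  shows "\<phi> i y \<in> pl_domain n l u" "br (\<phi> i y) = i" "T (\<phi> i y) = y"
proof -
  note * = br_eq[OF assms(1) \<phi>_interior[OF assms]]
  then show "\<phi> i y \<in> pl_domain n l u" "br (\<phi> i y) = i" by auto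
  then show "T (\<phi> i y) = y" using \<phi>_T \<phi>_inj[OF assms(1)] by metis
qed

lemma cyl_map_cong: "(\<And>k. k < m \<Longrightarrow> \<omega> k = \<omega>' k) \<Longrightarrow> cyl_map m \<omega> y = cyl_map m \<omega>' y"
  by (induction m arbitrary: y) auto

lemma cyl_map_affine:
  assumes "\<forall>k<m. \<omega> k \<in> {1..n}"
  shows "\<exists>c d. \<bar>d\<bar> = exp (- S m \<omega>) \<and> (\<forall>y. cyl_map m \<omega> y = c + d * y)"
  using assms
proof (induction m)
  case 0
  show ?case by (intro exI[of _ 0] exI[of _ 1]) (simp add: S_def)
next
  case (Suc m)
  obtain c d where cd: "\<bar>d\<bar> = exp (- S m \<omega>)" "\<And>y. cyl_map m \<omega> y = c + d * y"
    using Suc.IH Suc.prems less_Suc_eq by metis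
  have \<omega>: "\<omega> m \<in> {1..n}" using Suc.prems by simp
  obtain c' d' where cd': "\<bar>d'\<bar> = 1 / slope l u (\<omega> m)" "\<And>y. \<phi> (\<omega> m) y = c' + d' * y"
    using \<phi>_affine[OF \<omega>] by blast
  show ?case
    by (intro exI[of _ "c + d * c'"] exI[of _ "d * d'"])
       (auto simp: cd cd' abs_mult S_Suc exp_diff exp_minus exp_add exp_\<theta>[OF \<omega>] algebra_simps field_simps)
qed

lemma cyl_map_inj:
  assumes "\<forall>k<m. \<omega> k \<in> {1..n}" "cyl_map m \<omega> y = cyl_map m \<omega> z"
  shows "y = z"
proof -
  obtain c d where "\<bar>d\<bar> = exp (- S m \<omega>)" "\<And>y. cyl_map m \<omega> y = c + d * y"
    using cyl_map_affine[OF assms(1)] by blast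
  then show ?thesis using assms(2) by fastforce
qed

lemma cyl_map_diameter:
  assumes "\<forall>k<m. \<omega> k \<in> {1..n}" and "x \<in> cyl_map m \<omega> ` {0..1}" "y \<in> cyl_map m \<omega> ` {0..1}"
  shows "\<bar>x - y\<bar> \<le> exp (- S m \<omega>)"
proof -
  obtain c d where cd: "\<bar>d\<bar> = exp (- S m \<omega>)" "\<And>y. cyl_map m \<omega> y = c + d * y"
    using cyl_map_affine[OF assms(1)] by blast
  obtain a b where ab: "a \<in> {0..1}" "b \<in> {0..1}" "x - y = d * (a - b)"
    using assms(2,3) by (auto simp: cd(2) algebra_simps)
  have "\<bar>d\<bar> * \<bar>a - b\<bar> \<le> \<bar>d\<bar> * 1" using ab by (intro mult_left_mono) auto
  then show ?thesis by (simp add: ab(3) abs_mult cd(1))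
qed

lemma cyl_map_compact:
  assumes "\<forall>k<m. \<omega> k \<in> {1..n}"
  shows "compact (cyl_map m \<omega> ` {0..1})"
proof -
  obtain c d where "\<And>y. cyl_map m \<omega> y = c + d * y"
    using cyl_map_affine[OF assms] by blast
  then have "cyl_map m \<omega> = (\<lambda>y. c + d * y)" by auto
  then show ?thesis by (auto intro!: compact_continuous_image continuous_intros)
qed

lemma cyl_map_open_measure:
  assumes "\<forall>k<m. \<omega> k \<in> {1..n}"
  shows "cyl_map m \<omega> ` {0<..<1} \<in> sets lborel"
    "emeasure lborel (cyl_map m \<omega> ` {0<..<1}) = ennreal (exp (- S m \<omega>))"
proof -
  obtain c d where cd: "\<bar>d\<bar> = exp (- S m \<omega>)" "\<And>y. cyl_map m \<omega> y = c + d * y"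
    using cyl_map_affine[OF assms] by blast
  then have "d \<noteq> 0" by auto
  then have eq: "cyl_map m \<omega> ` {0<..<1} = {min c (c + d)<..<max c (c + d)}"
    using affine_image_open_interval[of d c] by (simp add: cd(2))
  show "cyl_map m \<omega> ` {0<..<1} \<in> sets lborel" by (simp add: eq)
  have "max c (c + d) - min c (c + d) = \<bar>d\<bar>" by auto
  then show "emeasure lborel (cyl_map m \<omega> ` {0<..<1}) = ennreal (exp (- S m \<omega>))"
    by (simp add: eq cd(1))
qed

lemma \<phi>_unit:
  assumes "i \<in> {1..n}"
  shows "y \<in> {0..1} \<Longrightarrow> \<phi> i y \<in> {0..1}" "y \<in> {0<..<1} \<Longrightarrow> \<phi> i y \<in> {0<..<1}"
proof -
  show "\<phi> i y \<in> {0..1}" if "y \<in> {0..1}"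
    using imageI[OF that, of "\<phi> i"] \<phi>_image[OF assms] interval[OF assms] by blast
  show "\<phi> i y \<in> {0<..<1}" if "y \<in> {0<..<1}"
    using \<phi>_interior[OF assms that] interval[OF assms] by auto
qed

lemma cyl_map_prefix:
  assumes "\<forall>k<m. \<omega> k \<in> {1..n}" "j \<le> m"
  shows "cyl_map m \<omega> ` {0..1} \<subseteq> cyl_map j \<omega> ` {0..1}"
    and "cyl_map m \<omega> ` {0<..<1} \<subseteq> cyl_map j \<omega> ` {0<..<1}"
proof -
  have *: "cyl_map m \<omega> ` A \<subseteq> cyl_map j \<omega> ` A"
    if A: "\<And>i. i \<in> {1..n} \<Longrightarrow> \<phi> i ` A \<subseteq> A" for A
    using assms(2,1)
  proof (induction m rule: dec_induct)
    case (step m)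
    have "cyl_map (Suc m) \<omega> ` A = cyl_map m \<omega> ` \<phi> (\<omega> m) ` A"
      by (simp add: image_image)
    also have "\<dots> \<subseteq> cyl_map m \<omega> ` A"
      using A[of "\<omega> m"] step(4) by (intro image_mono) simp
    also have "\<dots> \<subseteq> cyl_map j \<omega> ` A" using step(3,4) by simp
    finally show ?case .
  qed simp
  show "cyl_map m \<omega> ` {0..1} \<subseteq> cyl_map j \<omega> ` {0..1}"
    by (rule *) (use \<phi>_unit(1) in blast)
  show "cyl_map m \<omega> ` {0<..<1} \<subseteq> cyl_map j \<omega> ` {0<..<1}"
    by (rule *) (use \<phi>_unit(2) in blast)
qed

text \<open>Open cylinders, because adjacent closed ones may share an endpoint. Cancelling the
  common prefix by injectivity leaves one point on which \<open>br\<close> would have to read both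
  symbols at place \<open>j\<close>.\<close>

lemma cyl_map_disjoint:
  assumes "\<forall>k<m. \<omega> k \<in> {1..n}" "\<forall>k<m'. \<omega>' k \<in> {1..n}"
    and j: "j < m" "j < m'" "\<omega> j \<noteq> \<omega>' j" "\<And>k. k < j \<Longrightarrow> \<omega> k = \<omega>' k"
  shows "cyl_map m \<omega> ` {0<..<1} \<inter> cyl_map m' \<omega>' ` {0<..<1} = {}"
proof (rule ccontr)
  assume "cyl_map m \<omega> ` {0<..<1} \<inter> cyl_map m' \<omega>' ` {0<..<1} \<noteq> {}"
  then obtain x where x: "x \<in> cyl_map m \<omega> ` {0<..<1}" "x \<in> cyl_map m' \<omega>' ` {0<..<1}" by blast
  have "x \<in> cyl_map (Suc j) \<omega> ` {0<..<1}" "x \<in> cyl_map (Suc j) \<omega>' ` {0<..<1}"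
    using x cyl_map_prefix(2)[of m \<omega> "Suc j"] cyl_map_prefix(2)[of m' \<omega>' "Suc j"] assms by auto
  then obtain y z where yz: "y \<in> {0<..<1}" "z \<in> {0<..<1}"
      "x = cyl_map j \<omega> (\<phi> (\<omega> j) y)" "x = cyl_map j \<omega>' (\<phi> (\<omega>' j) z)" by auto
  have "cyl_map j \<omega> v = cyl_map j \<omega>' v" for v by (rule cyl_map_cong) (rule j(4))
  then have "cyl_map j \<omega> (\<phi> (\<omega> j) y) = cyl_map j \<omega> (\<phi> (\<omega>' j) z)"
    using yz(3,4) by metis
  then have "\<phi> (\<omega> j) y = \<phi> (\<omega>' j) z"
    by (rule cyl_map_inj[rotated]) (use assms(1) j(1) in auto)
  moreover have "br (\<phi> (\<omega> j) y) = \<omega> j" using assms(1) j(1) yz(1) by (intro \<phi>_coding(2)) auto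
  moreover have "br (\<phi> (\<omega>' j) z) = \<omega>' j" using assms(2) j(2) yz(2) by (intro \<phi>_coding(2)) auto
  ultimately show False using j(3) by simp
qed

text \<open>The coding map: closed cylinders are nested and compact, so a point to choose exists,
  and their diameters tend to 0 for admissible \<open>\<omega>\<close>.\<close>

definition \<pi> :: "(nat \<Rightarrow> nat) \<Rightarrow> real" where
  "\<pi> \<omega> = (SOME x. \<forall>m. x \<in> cyl_map m \<omega> ` {0..1})"

lemma \<pi>_in_cylinder:
  assumes "\<forall>k. \<omega> k \<in> {1..n}"
  shows "\<pi> \<omega> \<in> cyl_map m \<omega> ` {0..1}"
proof -
  have "\<Inter> (range (\<lambda>m. cyl_map m \<omega> ` {0..1})) \<noteq> {}"
    using assms by (intro compact_nest cyl_map_compact cyl_map_prefix) auto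
  then have "\<exists>x. \<forall>m. x \<in> cyl_map m \<omega> ` {0..1}" by auto
  then have "\<forall>m. \<pi> \<omega> \<in> cyl_map m \<omega> ` {0..1}" unfolding \<pi>_def by (rule someI_ex)
  then show ?thesis ..
qed

text \<open>The points whose orbit may hit an endpoint of a branch; only there can the coding be ambiguous.\<close>

definition boundary_points :: "real set" where
  "boundary_points = (\<Union>m. \<Union>\<omega>\<in>PiE {..<m} (\<lambda>_. {1..n}). cyl_map m \<omega> ` {0, 1})"

lemma countable_boundary_points: "countable boundary_points"
  unfolding boundary_points_def
  by (intro countable_UN) (auto intro!: countable_finite finite_PiE)

lemma boundary_pointsI:
  assumes "\<forall>k. \<omega> k \<in> {1..n}" "y \<in> {0, 1}"
  shows "cyl_map m \<omega> y \<in> boundary_points"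
proof -
  have "cyl_map m \<omega> y = cyl_map m (restrict \<omega> {..<m}) y" by (rule cyl_map_cong) simp
  moreover have "restrict \<omega> {..<m} \<in> PiE {..<m} (\<lambda>_. {1..n})" using assms(1) by auto
  ultimately show ?thesis unfolding boundary_points_def using assms(2) by blast
qed

text \<open>Off the boundary points, the relative position \<open>y m\<close> of
  \<open>\<pi> \<omega>\<close> in its \<open>m\<close>-th cylinder is interior, where
  \<open>T\<close> undoes \<open>\<phi>\<close>. The orbit is therefore \<open>y 0\<close>,
  \<open>y 1\<close>, ..., and \<open>br\<close> reads off the code.\<close>

lemma \<pi>_coding:
  assumes \<omega>: "\<forall>k. \<omega> k \<in> {1..n}" and nb: "\<pi> \<omega> \<notin> boundary_points"
  shows "(T ^^ m) (\<pi> \<omega>) \<in> pl_domain n l u" "br ((T ^^ m) (\<pi> \<omega>)) = \<omega> m"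
proof -
  have "\<exists>y\<in>{0<..<1}. \<pi> \<omega> = cyl_map m \<omega> y" for m
  proof -
    obtain y where y: "y \<in> {0..1}" "\<pi> \<omega> = cyl_map m \<omega> y"
      using \<pi>_in_cylinder[OF \<omega>] by blast
    then have "y \<noteq> 0" "y \<noteq> 1" using boundary_pointsI[OF \<omega>, of _ m] nb by auto
    then show ?thesis using y by (intro bexI[of _ y]) auto
  qed
  then obtain y where y: "\<And>m. y m \<in> {0<..<1}" "\<And>m. \<pi> \<omega> = cyl_map m \<omega> (y m)" by metis
  have step: "y m = \<phi> (\<omega> m) (y (Suc m))" for m
    by (rule cyl_map_inj[of m \<omega>]) (use \<omega> y(2)[of m] y(2)[of "Suc m"] in auto)
  have iter: "(T ^^ m) (\<pi> \<omega>) = y m" for m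
  proof (induction m)
    case 0
    then show ?case using y(2)[of 0] by simp
  next
    case (Suc m)
    then show ?case using \<phi>_coding(3)[OF \<omega>[rule_format] y(1)] step[of m] by simp
  qed
  show "(T ^^ m) (\<pi> \<omega>) \<in> pl_domain n l u" "br ((T ^^ m) (\<pi> \<omega>)) = \<omega> m"
    unfolding iter step[of m] using \<phi>_coding[OF \<omega>[rule_format] y(1)] by auto
qed

definition itinerary :: "real \<Rightarrow> nat \<Rightarrow> nat" where
  "itinerary x k = br ((T ^^ k) x)"

text \<open>No point is excluded here: \<open>br\<close> selects a branch everywhere on the domain
  and \<open>\<phi>_T\<close> follows that choice. Only the passage from codes to points loses a
  countable set.\<close>

lemma itinerary:
  assumes "x \<in> repeller n l u T"
  shows "itinerary x k \<in> {1..n}" "x \<in> cyl_map m (itinerary x) ` {0..1}"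
proof -
  have dom: "(T ^^ k) x \<in> pl_domain n l u" for k using assms by (auto simp: repeller_def)
  show "itinerary x k \<in> {1..n}" using branch[OF dom] by (simp add: itinerary_def)
  have "cyl_map m (itinerary x) ((T ^^ m) x) = x"
    by (induction m) (use \<phi>_T[OF dom] in \<open>auto simp: itinerary_def\<close>)
  then show "x \<in> cyl_map m (itinerary x) ` {0..1}"
    using dom[of m] domain_subset by (metis image_eqI subsetD)
qed

definition level_set :: "real \<Rightarrow> real set" where
  "level_set a = {x \<in> repeller n l u T. has_lyapunov_exponent l u br T x a}"

lemma level_set_iff:
  assumes "x \<in> repeller n l u T"
  shows "x \<in> level_set a \<longleftrightarrow> (\<lambda>m. S m (itinerary x) / real m) \<longlonglongrightarrow> a"
proof -
  have "slope l u (br ((T ^^ k) x)) = exp (\<theta> (itinerary x k))" for k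
    using itinerary(1)[OF assms, of k] by (simp add: exp_\<theta> itinerary_def)
  then have "abs_deriv_iterate l u br T m x = exp (S m (itinerary x))" for m
    by (simp add: abs_deriv_iterate_def S_def exp_sum)
  then show ?thesis using assms by (simp add: level_set_def has_lyapunov_exponent_def)
qed

subsection \<open>Dimension of the level sets\<close>

text \<open>The summands are the Bernoulli masses of the cylinders of depth \<open>m\<close>;
  expanding the \<open>m\<close>-th power of the total weight 1 produces them.\<close>

lemma sum_prod_weights:
  assumes norm: "(\<Sum>i\<in>{1..n}. exp (t * \<theta> i - P)) = 1"
  shows "(\<Sum>\<omega>\<in>PiE {..<m} (\<lambda>_. {1..n}). exp (t * S m \<omega> - real m * P)) = 1"
proof -
  have "exp (t * S m \<omega> - real m * P) = (\<Prod>k<m. exp (t * \<theta> (\<omega> k) - P))" for \<omega>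
    by (simp add: S_def exp_sum[symmetric] sum_subtractf sum_distrib_left)
  then have "(\<Sum>\<omega>\<in>PiE {..<m} (\<lambda>_. {1..n}). exp (t * S m \<omega> - real m * P))
      = (\<Prod>k<m. \<Sum>i\<in>{1..n}. exp (t * \<theta> i - P))"
    by (subst prod_sum_PiE) auto
  then show ?thesis by (simp only: norm) simp
qed

text \<open>A cylinder of length \<open>exp (- S m \<omega>)\<close> has weight \<open>exp (t * S m \<omega> - m * P)\<close>; where the Birkhoff
  averages are close to \<open>a\<close>, the former raised to the power \<open>s\<close> is exponentially smaller.\<close>

lemma level_set_null:
  assumes norm: "(\<Sum>i\<in>{1..n}. exp (t * \<theta> i - P)) = 1" and s: "s > 0" "(s + t) * a > P"
  shows "hausdorff_measure s (level_set a) = 0"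
proof -
  \<comment> \<open>Half of the gap: one half absorbs the deviation of \<open>S\<close>, the other
    is left as the decay \<open>exp (- m * \<kappa>)\<close>.\<close>
  define \<kappa> where "\<kappa> = ((s + t) * a - P) / 2"
  have \<kappa>: "\<kappa> > 0" "(s + t) * a - \<kappa> = P + \<kappa>" using s(2) by (auto simp: \<kappa>_def field_simps)
  \<comment> \<open>The \<open>+ 1\<close> covers the case \<open>s + t = 0\<close>.\<close>
  define \<epsilon> where "\<epsilon> = \<kappa> / (\<bar>s + t\<bar> + 1)"
  have \<epsilon>: "\<epsilon> > 0" "\<bar>s + t\<bar> * \<epsilon> \<le> \<kappa>" using \<kappa>(1) by (auto simp: \<epsilon>_def field_simps)
  \<comment> \<open>Points whose averages are controlled from a common depth \<open>N\<close> on can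
    be covered by cylinders of a single depth; countably many such sets exhaust the level
    set.\<close>
  define E where "E N = {x \<in> repeller n l u T.
      \<forall>m\<ge>N. \<bar>S m (itinerary x) - real m * a\<bar> \<le> real m * \<epsilon>}" for N
  have "hausdorff_measure s (E N) = 0" for N
  proof (rule hausdorff_measure_eq_0_finite_cover)
    fix \<delta> \<eta> :: real assume pos: "\<delta> > 0" "\<eta> > 0"
    have \<theta>1: "\<theta> 1 > 0" using branches_nonempty by (intro \<theta>_pos) auto
    have "eventually (\<lambda>m. exp (- (real m * \<theta> 1)) < \<delta>) sequentially"
        "eventually (\<lambda>m. exp (- (real m * \<kappa>)) < \<eta>) sequentially"
      using order_tendstoD(2)[OF exp_decay[OF \<theta>1] pos(1)] order_tendstoD(2)[OF exp_decay[OF \<kappa>(1)] pos(2)] .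
    then have "eventually (\<lambda>m. exp (- (real m * \<theta> 1)) < \<delta> \<and> exp (- (real m * \<kappa>)) < \<eta> \<and> m \<ge> N) sequentially"
      using eventually_ge_at_top by eventually_elim auto
    then obtain m where m: "exp (- (real m * \<theta> 1)) < \<delta>" "exp (- (real m * \<kappa>)) < \<eta>" "m \<ge> N"
      using eventually_happens'[OF sequentially_bot] by blast
    define W where "W = PiE {..<m} (\<lambda>_. {1..n})"
    define K where "K = {\<omega> \<in> W. \<bar>S m \<omega> - real m * a\<bar> \<le> real m * \<epsilon>}"
    have fin: "finite W" by (auto simp: W_def intro: finite_PiE)
    have Wn: "\<forall>k<m. \<omega> k \<in> {1..n}" if "\<omega> \<in> K" for \<omega>
    proof -
      have "\<omega> \<in> PiE {..<m} (\<lambda>_. {1..n})" using that unfolding K_def W_def by blast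
      then show ?thesis by (meson PiE_mem lessThan_iff)
    qed
    have diam: "diameter (cyl_map m \<omega> ` {0..1}) \<le> exp (- S m \<omega>)" if "\<omega> \<in> K" for \<omega>
    proof (rule diameter_le)
      fix x y assume "x \<in> cyl_map m \<omega> ` {0..1}" "y \<in> cyl_map m \<omega> ` {0..1}"
      with cyl_map_diameter[OF Wn[OF that]] show "norm (x - y) \<le> exp (- S m \<omega>)" by simp
    qed simp
    have "E N \<subseteq> (\<Union>\<omega>\<in>K. cyl_map m \<omega> ` {0..1})"
    proof
      fix x assume x: "x \<in> E N"
      then have rep: "x \<in> repeller n l u T" by (simp add: E_def)
      let ?\<omega> = "restrict (itinerary x) {..<m}"
      have "S m ?\<omega> = S m (itinerary x)" by (rule S_cong) simp
      then have "?\<omega> \<in> K"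
        using itinerary(1)[OF rep] x m(3) by (auto simp: K_def W_def E_def)
      moreover have "cyl_map m ?\<omega> y = cyl_map m (itinerary x) y" for y by (rule cyl_map_cong) simp
      then have "x \<in> cyl_map m ?\<omega> ` {0..1}" using itinerary(2)[OF rep, of m] by auto
      ultimately show "x \<in> (\<Union>\<omega>\<in>K. cyl_map m \<omega> ` {0..1})" by blast
    qed
    moreover have "diameter (cyl_map m \<omega> ` {0..1}) \<le> \<delta>" if "\<omega> \<in> K" for \<omega>
    proof -
      have "exp (- S m \<omega>) \<le> exp (- (real m * \<theta> 1))" using S_bounds(1)[OF Wn[OF that]] by simp
      with diam[OF that] m(1) show ?thesis by linarith
    qed
    moreover have "bounded (cyl_map m \<omega> ` {0..1})" if "\<omega> \<in> K" for \<omega>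
      using cyl_map_compact[OF Wn[OF that]] by (rule compact_imp_bounded)
    moreover have "(\<Sum>\<omega>\<in>K. diameter (cyl_map m \<omega> ` {0..1}) powr s) < \<eta>"
    proof -
      have "diameter (cyl_map m \<omega> ` {0..1}) powr s \<le> exp (- (real m * \<kappa>)) * exp (t * S m \<omega> - real m * P)"
        if "\<omega> \<in> K" for \<omega>
      proof -
        have "diameter (cyl_map m \<omega> ` {0..1}) powr s \<le> exp (- S m \<omega>) powr s"
          using diam[OF that] s(1) cyl_map_compact[OF Wn[OF that]]
          by (intro powr_mono2) (auto intro: diameter_ge_0 compact_imp_bounded)
        also have "\<dots> = exp (- s * S m \<omega>)" by (simp add: powr_def)
        also have "\<dots> \<le> exp (- (real m * \<kappa>) + (t * S m \<omega> - real m * P))"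
        proof -
          have "real m * (P + \<kappa>) \<le> (s + t) * S m \<omega>"
            using deviation_bound(1)[OF _ \<epsilon>(2), of "S m \<omega>" m a] that \<kappa>(2) by (auto simp: K_def)
          then show ?thesis by (simp add: algebra_simps)
        qed
        finally show ?thesis by (simp only: exp_add)
      qed
      then have "(\<Sum>\<omega>\<in>K. diameter (cyl_map m \<omega> ` {0..1}) powr s)
          \<le> (\<Sum>\<omega>\<in>K. exp (- (real m * \<kappa>)) * exp (t * S m \<omega> - real m * P))"
        by (rule sum_mono)
      also have "\<dots> \<le> (\<Sum>\<omega>\<in>W. exp (- (real m * \<kappa>)) * exp (t * S m \<omega> - real m * P))"
        using fin by (intro sum_mono2) (auto simp: K_def)
      also have "\<dots> = exp (- (real m * \<kappa>))"
        using sum_prod_weights[OF norm, of m] by (simp add: W_def sum_distrib_left[symmetric])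
      finally show ?thesis using m(2) by linarith
    qed
    moreover have "finite K" using fin by (simp add: K_def)
    ultimately show "\<exists>(K :: (nat \<Rightarrow> nat) set) U. finite K \<and> E N \<subseteq> (\<Union>k\<in>K. U k) \<and>
        (\<forall>k\<in>K. bounded (U k) \<and> diameter (U k) \<le> \<delta>) \<and> (\<Sum>k\<in>K. diameter (U k) powr s) < \<eta>"
      by (intro exI[of _ K] exI[of _ "\<lambda>\<omega>. cyl_map m \<omega> ` {0..1}"]) auto
  qed
  then have "hausdorff_measure s (\<Union>N. E N) = 0" by (rule hausdorff_measure_eq_0_UN)
  moreover have "level_set a \<subseteq> (\<Union>N. E N)"
  proof
    fix x assume x: "x \<in> level_set a"
    then have rep: "x \<in> repeller n l u T" by (simp add: level_set_def)
    then have "(\<lambda>m. S m (itinerary x) / real m) \<longlonglongrightarrow> a" using x level_set_iff by blast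
    then have "eventually (\<lambda>m. \<bar>S m (itinerary x) / real m - a\<bar> < \<epsilon>) sequentially"
      using \<epsilon>(1) by (auto dest: tendstoD simp: dist_real_def)
    then have "eventually (\<lambda>m. \<bar>S m (itinerary x) - real m * a\<bar> \<le> real m * \<epsilon>) sequentially"
      using eventually_gt_at_top[of 0] by eventually_elim (rule average_deviation)
    then show "x \<in> (\<Union>N. E N)"
      using rep by (auto simp: E_def eventually_sequentially)
  qed
  ultimately show ?thesis by (rule hausdorff_measure_eq_0_mono)
qed

text \<open>A stopping time in place of a fixed depth: cutting each code where its cylinder first
  has length at most \<open>d\<close> makes all the cylinders comparable in length to
  \<open>d\<close>.\<close>

definition stop :: "real \<Rightarrow> (nat \<Rightarrow> nat) \<Rightarrow> nat" where
  "stop d \<omega> = (LEAST m. exp (- S m \<omega>) \<le> d)"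

text \<open>One symbol shrinks a cylinder by at most the factor \<open>exp (- \<theta> n)\<close>.
  Hence the stopped length is not far below \<open>d\<close>, and small \<open>d\<close> forces late
  stopping; the latter brings stopped cylinders into the range of depths where averages are
  controlled.\<close>

lemma stop:
  assumes \<omega>: "\<forall>k. \<omega> k \<in> {1..n}" and d: "0 < d" "d < 1"
  shows "exp (- S (stop d \<omega>) \<omega>) \<le> d" "d * exp (- \<theta> n) \<le> exp (- S (stop d \<omega>) \<omega>)"
    "d \<le> exp (- (real N * \<theta> n)) \<Longrightarrow> N \<le> stop d \<omega>"
proof -
  have \<theta>: "\<theta> 1 > 0" "\<theta> n > 0" using branches_nonempty by (auto intro: \<theta>_pos)
  have "eventually (\<lambda>m. exp (- (real m * \<theta> 1)) < d) sequentially"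
    using order_tendstoD(2)[OF exp_decay[OF \<theta>(1)] d(1)] .
  then obtain m where "exp (- (real m * \<theta> 1)) < d" by (auto simp: eventually_sequentially)
  moreover have "exp (- S m \<omega>) \<le> exp (- (real m * \<theta> 1))" using S_bounds(1)[of m \<omega>] \<omega> by simp
  ultimately have "exp (- S m \<omega>) \<le> d" by linarith
  then show le: "exp (- S (stop d \<omega>) \<omega>) \<le> d" unfolding stop_def by (rule LeastI)
  \<comment> \<open>The cylinder of depth 0 has length 1, which exceeds \<open>d\<close>.\<close>
  have "stop d \<omega> \<noteq> 0"
  proof
    assume "stop d \<omega> = 0"
    then show False using le d by (simp add: S_def)
  qed
  then obtain k where k: "stop d \<omega> = Suc k" by (cases "stop d \<omega>") auto
  have "d < exp (- S k \<omega>)"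
    using not_less_Least[of k "\<lambda>m. exp (- S m \<omega>) \<le> d"] k by (simp add: stop_def not_le)
  moreover have "\<theta> (\<omega> k) \<le> \<theta> n" using \<omega> by (intro \<theta>_mono) auto
  then have "exp (- S k \<omega>) * exp (- \<theta> n) \<le> exp (- S (stop d \<omega>) \<omega>)"
    by (simp add: k S_Suc flip: exp_add)
  ultimately show "d * exp (- \<theta> n) \<le> exp (- S (stop d \<omega>) \<omega>)"
    by (meson exp_ge_zero less_imp_le mult_right_mono order_trans)
  assume N: "d \<le> exp (- (real N * \<theta> n))"
  have "exp (- (real (stop d \<omega>) * \<theta> n)) \<le> exp (- S (stop d \<omega>) \<omega>)"
    using S_bounds(2)[of "stop d \<omega>" \<omega>] \<omega> by simp
  then have "exp (- (real (stop d \<omega>) * \<theta> n)) \<le> exp (- (real N * \<theta> n))" using le N by linarith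
  then show "N \<le> stop d \<omega>" using \<theta> by simp
qed

text \<open>Whether to stop at a depth is decided by the prefix of that length, so no stopped word
  is a proper prefix of another.\<close>

lemma stop_prefix_differ:
  assumes \<omega>: "\<forall>k. \<omega> k \<in> {1..n}" "\<forall>k. \<omega>' k \<in> {1..n}" and d: "0 < d" "d < 1"
    and neq: "map \<omega> [0..<stop d \<omega>] \<noteq> map \<omega>' [0..<stop d \<omega>']"
  shows "\<exists>j. j < stop d \<omega> \<and> j < stop d \<omega>' \<and> \<omega> j \<noteq> \<omega>' j \<and> (\<forall>k<j. \<omega> k = \<omega>' k)"
proof -
  have aux: "stop d \<beta> = stop d \<gamma>"
    if "\<forall>k. \<beta> k \<in> {1..n}" "\<forall>k. \<gamma> k \<in> {1..n}" "stop d \<beta> \<le> stop d \<gamma>" "\<forall>k<stop d \<beta>. \<beta> k = \<gamma> k" for \<beta> \<gamma>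
  proof -
    have "S (stop d \<beta>) \<gamma> = S (stop d \<beta>) \<beta>" by (rule S_cong) (use that in auto)
    then have "exp (- S (stop d \<beta>) \<gamma>) \<le> d" using stop(1)[OF that(1) d] by simp
    then have "stop d \<gamma> \<le> stop d \<beta>" unfolding stop_def[of d \<gamma>] by (rule Least_le)
    with that show ?thesis by simp
  qed
  have "\<exists>j. j < stop d \<omega> \<and> j < stop d \<omega>' \<and> \<omega> j \<noteq> \<omega>' j"
  proof (rule ccontr)
    assume "\<nexists>j. j < stop d \<omega> \<and> j < stop d \<omega>' \<and> \<omega> j \<noteq> \<omega>' j"
    then have eq: "\<forall>k. k < stop d \<omega> \<longrightarrow> k < stop d \<omega>' \<longrightarrow> \<omega> k = \<omega>' k" by blast
    have "stop d \<omega> = stop d \<omega>'"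
    proof (cases "stop d \<omega> \<le> stop d \<omega>'")
      case True
      then show ?thesis using aux[OF \<omega>] eq by auto
    next
      case False
      then have "stop d \<omega>' = stop d \<omega>" using eq by (intro aux[OF \<omega>(2,1)]) auto
      then show ?thesis by simp
    qed
    with neq eq show False by auto
  qed
  then obtain j where j: "j < stop d \<omega> \<and> j < stop d \<omega>' \<and> \<omega> j \<noteq> \<omega>' j"
      "\<And>k. k < j \<Longrightarrow> \<not> (k < stop d \<omega> \<and> k < stop d \<omega>' \<and> \<omega> k \<noteq> \<omega>' k)"
    using exists_least_iff[of "\<lambda>j. j < stop d \<omega> \<and> j < stop d \<omega>' \<and> \<omega> j \<noteq> \<omega>' j"] by blast
  then show ?thesis by (intro exI[of _ j]) auto
qed

text \<open>Stopped cylinders meeting a set of diameter \<open>d\<close> have disjoint interiors, length at least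
  \<open>d * exp (- \<theta> n)\<close>, and lie in an interval of length \<open>4 * d\<close>.\<close>

lemma card_stopped_cylinders:
  assumes G: "\<forall>\<omega>\<in>G. \<forall>k. \<omega> k \<in> {1..n}" and d: "0 < d" "d < 1"
    and U: "bounded U" "diameter U \<le> d"
  defines "W \<equiv> (\<lambda>\<omega>. map \<omega> [0..<stop d \<omega>]) ` {\<omega> \<in> G. \<pi> \<omega> \<in> U}"
  shows "finite W \<and> card W \<le> nat \<lfloor>4 * exp (\<theta> n)\<rfloor>"
proof (rule finite_if_finite_subsets_card_bdd)
  fix Q assume Q: "Q \<subseteq> W" "finite Q"
  have "\<forall>w\<in>Q. \<exists>\<omega>. \<omega> \<in> G \<and> \<pi> \<omega> \<in> U \<and> w = map \<omega> [0..<stop d \<omega>]" using Q(1) by (auto simp: W_def)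
  then obtain \<omega> where \<omega>: "\<And>w. w \<in> Q \<Longrightarrow> \<omega> w \<in> G" "\<And>w. w \<in> Q \<Longrightarrow> \<pi> (\<omega> w) \<in> U"
      "\<And>w. w \<in> Q \<Longrightarrow> w = map (\<omega> w) [0..<stop d (\<omega> w)]" by metis
  have \<omega>n: "\<forall>k. \<omega> w k \<in> {1..n}" if "w \<in> Q" for w using G \<omega>(1)[OF that] by blast
  define J where "J w = cyl_map (stop d (\<omega> w)) (\<omega> w) ` {0<..<1}" for w
  show "card Q \<le> nat \<lfloor>4 * exp (\<theta> n)\<rfloor>"
  proof (cases "U = {}")
    case True
    then have "Q = {}" using \<omega>(2) by blast
    then show ?thesis by simp
  next
    case False
    then obtain z where z: "z \<in> U" by blast
    \<comment> \<open>One \<open>d\<close> for the length of the cylinder, which has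
      \<open>\<pi> (\<omega> w)\<close> in its closure, and one for the diameter of
      \<open>U\<close>.\<close>
    have sub: "J w \<subseteq> {z - 2 * d..z + 2 * d}" if w: "w \<in> Q" for w
    proof
      fix x assume "x \<in> J w"
      then have "x \<in> cyl_map (stop d (\<omega> w)) (\<omega> w) ` {0..1}" unfolding J_def by auto
      then have "\<bar>x - \<pi> (\<omega> w)\<bar> \<le> exp (- S (stop d (\<omega> w)) (\<omega> w))"
        using \<omega>n[OF w] \<pi>_in_cylinder[OF \<omega>n[OF w]] by (intro cyl_map_diameter) auto
      then have "\<bar>x - \<pi> (\<omega> w)\<bar> \<le> d" using stop(1)[OF \<omega>n[OF w] d] by linarith
      moreover have "\<bar>\<pi> (\<omega> w) - z\<bar> \<le> d"
        using diameter_bounded_bound[OF U(1) \<omega>(2)[OF w] z] U(2) by (simp add: dist_real_def)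
      ultimately show "x \<in> {z - 2 * d..z + 2 * d}" by (auto simp: abs_le_iff)
    qed
    have meas: "J w \<in> sets lborel" "emeasure lborel (J w) \<ge> ennreal (d * exp (- \<theta> n))" if w: "w \<in> Q" for w
      using cyl_map_open_measure[of "stop d (\<omega> w)" "\<omega> w"] \<omega>n[OF w] stop(2)[OF \<omega>n[OF w] d]
      by (auto simp: J_def intro: ennreal_leI)
    have disj: "disjoint_family_on J Q"
      unfolding disjoint_family_on_def
    proof (intro ballI impI)
      fix v w assume vw: "v \<in> Q" "w \<in> Q" "v \<noteq> w"
      then obtain j where "j < stop d (\<omega> v)" "j < stop d (\<omega> w)" "\<omega> v j \<noteq> \<omega> w j" "\<forall>k<j. \<omega> v k = \<omega> w k"
        using stop_prefix_differ[OF \<omega>n[OF vw(1)] \<omega>n[OF vw(2)] d] \<omega>(3) by metis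
      then show "J v \<inter> J w = {}"
        unfolding J_def using \<omega>n vw by (intro cyl_map_disjoint[of _ _ _ _ j]) auto
    qed
    have "of_nat (card Q) * ennreal (d * exp (- \<theta> n)) \<le> (\<Sum>w\<in>Q. emeasure lborel (J w))"
      using meas(2) by (rule sum_bounded_below)
    also have "\<dots> = emeasure lborel (\<Union>w\<in>Q. J w)"
      using meas(1) disj Q(2) by (intro sum_emeasure) auto
    also have "\<dots> \<le> emeasure lborel {z - 2 * d..z + 2 * d}"
      using sub by (intro emeasure_mono) auto
    also have "\<dots> = ennreal (4 * d)" using d by simp
    finally have "ennreal (real (card Q) * (d * exp (- \<theta> n))) \<le> ennreal (4 * d)"
      using d by (simp add: ennreal_mult ennreal_of_nat_eq_real_of_nat)
    then have "real (card Q) * (d * exp (- \<theta> n)) \<le> 4 * d" using d by simp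
    then have "real (card Q) * exp (- \<theta> n) \<le> 4" using d by (simp add: mult.left_commute[of _ d])
    then have "real (card Q) \<le> 4 * exp (\<theta> n)" by (simp add: exp_minus field_simps)
    then show ?thesis by linarith
  qed
qed

text \<open>The Bernoulli measure with weights \<open>exp (t * \<theta> i - P)\<close> has mean
  exponent \<open>a\<close>, so almost every code has averages tending to \<open>a\<close>. On a set
  of positive mass the deviations are uniformly small from some depth on, which bounds the mass of
  stopped cylinders by \<open>d powr s\<close>. That set projects into the level set up to countably
  many points.\<close>

lemma level_set_not_null:
  assumes norm: "(\<Sum>i\<in>{1..n}. exp (t * \<theta> i - P)) = 1"
    and mean: "(\<Sum>i\<in>{1..n}. exp (t * \<theta> i - P) * \<theta> i) = a"
    and s: "s > 0" "(s + t) * a < P"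
  shows "hausdorff_measure s (level_set a) \<noteq> 0"
proof
  assume null: "hausdorff_measure s (level_set a) = 0"
  \<comment> \<open>Here the whole gap may go into the deviation: mass at most length to the power
    \<open>s\<close> suffices, with no decay left over.\<close>
  define \<kappa> where "\<kappa> = P - (s + t) * a"
  have \<kappa>: "\<kappa> > 0" using s(2) by (simp add: \<kappa>_def)
  define \<epsilon> where "\<epsilon> = \<kappa> / (\<bar>s + t\<bar> + 1)"
  have \<epsilon>: "\<epsilon> > 0" "\<bar>s + t\<bar> * \<epsilon> \<le> \<kappa>" using \<kappa> by (auto simp: \<epsilon>_def field_simps)
  define M where "M = point_measure {1..n} (\<lambda>i. ennreal (exp (t * \<theta> i - P)))"
  have M: "space M = {1..n}" "sets M = Pow {1..n}"
    by (auto simp: M_def space_point_measure sets_point_measure)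
  have "(\<Sum>i\<in>{1..n}. ennreal (exp (t * \<theta> i - P))) = 1"
    using norm by (subst sum_ennreal) auto
  then interpret M: prob_space M
    unfolding M_def by (intro prob_spaceI) (auto simp: emeasure_point_measure_finite space_point_measure)
  interpret product_prob_space "\<lambda>_. M" "UNIV :: nat set" by unfold_locales
  let ?P = "PiM (UNIV :: nat set) (\<lambda>_. M)"
  have space: "\<forall>k. \<omega> k \<in> {1..n}" if "\<omega> \<in> space ?P" for \<omega>
    using that by (auto simp: space_PiM M PiE_iff)
  have cyl: "{\<omega>' \<in> space ?P. \<forall>k\<in>{..<m}. \<omega>' k \<in> {\<omega> k}} \<in> sets ?P"
    "emeasure ?P {\<omega>' \<in> space ?P. \<forall>k\<in>{..<m}. \<omega>' k \<in> {\<omega> k}} = ennreal (exp (t * S m \<omega> - real m * P))"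
    if \<omega>: "\<omega> \<in> space ?P" for \<omega> m
  proof -
    have \<omega>k: "\<omega> k \<in> {1..n}" for k using space[OF \<omega>] by blast
    have *: "{\<omega> k} \<in> sets M" for k using \<omega>k[of k] by (auto simp: M)
    show "{\<omega>' \<in> space ?P. \<forall>k\<in>{..<m}. \<omega>' k \<in> {\<omega> k}} \<in> sets ?P"
      using * by (intro sets.sets_Collect_finite_All sets_Collect_single) auto
    have "emeasure M {\<omega> k} = ennreal (exp (t * \<theta> (\<omega> k) - P))" for k
      unfolding M_def using \<omega>k[of k] by (subst emeasure_point_measure_finite) auto
    then have "emeasure ?P {\<omega>' \<in> space ?P. \<forall>k\<in>{..<m}. \<omega>' k \<in> {\<omega> k}}
        = (\<Prod>k<m. ennreal (exp (t * \<theta> (\<omega> k) - P)))"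
      using * by (subst emeasure_PiM_Collect) auto
    also have "\<dots> = ennreal (\<Prod>k<m. exp (t * \<theta> (\<omega> k) - P))" by (rule prod_ennreal) simp
    also have "(\<Prod>k<m. exp (t * \<theta> (\<omega> k) - P)) = exp (t * S m \<omega> - real m * P)"
      by (simp add: S_def exp_sum[symmetric] sum_subtractf sum_distrib_left)
    finally show "emeasure ?P {\<omega>' \<in> space ?P. \<forall>k\<in>{..<m}. \<omega>' k \<in> {\<omega> k}}
        = ennreal (exp (t * S m \<omega> - real m * P))" .
  qed
  have \<theta>_meas[measurable]: "\<theta> \<in> borel_measurable M"
    by (simp add: M_def)
  have mean': "(\<integral>i. \<theta> i \<partial>M) = a"
    unfolding M_def mean[symmetric] by (subst lebesgue_integral_point_measure_finite) auto
  have "\<theta> i \<in> {\<theta> 1..\<theta> n}" if "i \<in> space M" for i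
    using that by (auto simp: M intro!: \<theta>_mono)
  from SLLN_bounded[OF M.prob_space_axioms \<theta>_meas this]
  have lln: "AE \<omega> in ?P. (\<lambda>m. S m \<omega> / real m) \<longlonglongrightarrow> a"
    by (simp only: mean' S_def)
  then obtain Z where Z: "{\<omega> \<in> space ?P. \<not> (\<lambda>m. S m \<omega> / real m) \<longlonglongrightarrow> a} \<subseteq> Z"
      "emeasure ?P Z = 0" "Z \<in> sets ?P"
    by (rule AE_E)
  have S_meas[measurable]: "S m \<in> borel_measurable ?P" for m
    unfolding S_def by measurable
  \<comment> \<open>Removing the measurable null set \<open>Z\<close> around the divergent codes
    keeps \<open>G N\<close> measurable and secures convergence on all of it.\<close>
  define G where "G N = {\<omega> \<in> space ?P. \<forall>m\<ge>N. \<bar>S m \<omega> - real m * a\<bar> \<le> real m * \<epsilon>} - Z" for N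
  have G_sets: "G N \<in> sets ?P" for N
    unfolding G_def using Z(3) by measurable
  have G: "\<omega> \<in> space ?P" "\<forall>k. \<omega> k \<in> {1..n}" "(\<lambda>m. S m \<omega> / real m) \<longlonglongrightarrow> a"
      "N \<le> m \<Longrightarrow> \<bar>S m \<omega> - real m * a\<bar> \<le> real m * \<epsilon>" if "\<omega> \<in> G N" for \<omega> N m
    using that space[of \<omega>] Z(1) unfolding G_def by blast+
  have "\<exists>N. emeasure ?P (G N) \<noteq> 0"
  proof (rule ccontr)
    assume "\<nexists>N. emeasure ?P (G N) \<noteq> 0"
    then have "G N \<in> null_sets ?P" for N using G_sets by (auto intro: null_setsI)
    then have "(\<Union>N. G N) \<in> null_sets ?P" by (rule null_sets_UN)
    moreover have "Z \<in> null_sets ?P" using Z by (intro null_setsI) auto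
    ultimately have "(\<Union>N. G N) \<union> Z \<in> null_sets ?P" by (rule null_sets.Un)
    moreover have "space ?P \<subseteq> (\<Union>N. G N) \<union> Z"
    proof
      fix \<omega> assume \<omega>: "\<omega> \<in> space ?P"
      show "\<omega> \<in> (\<Union>N. G N) \<union> Z"
      proof (cases "\<omega> \<in> Z")
        case False
        then have "(\<lambda>m. S m \<omega> / real m) \<longlonglongrightarrow> a" using Z(1) \<omega> by blast
        then have "eventually (\<lambda>m. \<bar>S m \<omega> / real m - a\<bar> < \<epsilon>) sequentially"
          using \<epsilon>(1) by (auto dest: tendstoD simp: dist_real_def)
        then have "eventually (\<lambda>m. \<bar>S m \<omega> - real m * a\<bar> \<le> real m * \<epsilon>) sequentially"
          using eventually_gt_at_top[of 0] by eventually_elim (rule average_deviation)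
        then show ?thesis
          using \<omega> False by (auto simp: G_def eventually_sequentially)
      qed simp
    qed
    ultimately have "emeasure ?P (space ?P) = 0"
      by (metis emeasure_eq_0 null_setsD1 null_setsD2)
    then show False using P.emeasure_space_1 by simp
  qed
  then obtain N where N: "emeasure ?P (G N) \<noteq> 0" ..
  have \<theta>n: "\<theta> n > 0" using branches_nonempty by (intro \<theta>_pos) auto
  have "hausdorff_measure s (\<pi> ` G N) \<noteq> 0"
  proof (rule mass_distribution_principle[OF s(1) _ _ G_sets N])
    \<comment> \<open>\<open>Suc N\<close> makes this scale smaller than 1 even for
      \<open>N = 0\<close>, as \<open>stop\<close> requires \<open>d < 1\<close>.\<close>
    show "exp (- (real (Suc N) * \<theta> n)) > 0" "4 * exp (\<theta> n) \<ge> 0" by simp_all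
    fix U :: "real set" and d assume U: "bounded U" "diameter U \<le> d" and d: "0 < d" "d \<le> exp (- (real (Suc N) * \<theta> n))"
    have "exp (- (real (Suc N) * \<theta> n)) < 1" using \<theta>n by (simp add: mult_pos_pos)
    then have d1: "d < 1" using d(2) by linarith
    have dN: "d \<le> exp (- (real N * \<theta> n))"
      using d(2) \<theta>n by (smt (verit) exp_le_cancel_iff mult_right_mono of_nat_Suc)
    define W where "W = (\<lambda>\<omega>. map \<omega> [0..<stop d \<omega>]) ` {\<omega> \<in> G N. \<pi> \<omega> \<in> U}"
    have W: "finite W" "card W \<le> nat \<lfloor>4 * exp (\<theta> n)\<rfloor>"
      using card_stopped_cylinders[OF _ d(1) d1 U, of "G N"] G(2) unfolding W_def by simp_all
    have "real (card W) \<le> real (nat \<lfloor>4 * exp (\<theta> n)\<rfloor>)" using W(2) by (rule of_nat_mono)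
    also have "\<dots> \<le> 4 * exp (\<theta> n)" by (rule of_nat_floor) simp
    finally have Wcard: "real (card W) \<le> 4 * exp (\<theta> n)" .
    have "\<forall>w\<in>W. \<exists>\<omega>. \<omega> \<in> G N \<and> w = map \<omega> [0..<stop d \<omega>]" by (auto simp: W_def)
    then obtain \<omega> where \<omega>: "\<And>w. w \<in> W \<Longrightarrow> \<omega> w \<in> G N" "\<And>w. w \<in> W \<Longrightarrow> w = map (\<omega> w) [0..<stop d (\<omega> w)]"
      by metis
    define C where "C w = {\<omega>' \<in> space ?P. \<forall>k\<in>{..<stop d (\<omega> w)}. \<omega>' k \<in> {\<omega> w k}}" for w
    have C: "C w \<in> sets ?P" "emeasure ?P (C w) \<le> ennreal (d powr s)" if w: "w \<in> W" for w
    proof -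
      define m where "m = stop d (\<omega> w)"
      note \<omega>w = G[OF \<omega>(1)[OF w]]
      have m: "exp (- S m (\<omega> w)) \<le> d" "N \<le> m"
        using stop[OF \<omega>w(2) d(1) d1] dN by (auto simp: m_def)
      show "C w \<in> sets ?P" unfolding C_def by (rule cyl(1)[OF \<omega>w(1)])
      \<comment> \<open>Rearranged, \<open>t * S - m * P \<le> - s * S\<close>: the mass of the
        cylinder is at most its length to the power \<open>s\<close>.\<close>
      have "(s + t) * S m (\<omega> w) \<le> real m * P"
        using deviation_bound(2)[OF \<omega>w(4)[OF m(2)] \<epsilon>(2)] by (simp add: \<kappa>_def)
      then have "exp (t * S m (\<omega> w) - real m * P) \<le> exp (- S m (\<omega> w)) powr s"
        by (simp add: powr_def algebra_simps)
      also have "\<dots> \<le> d powr s" using m(1) s(1) by (intro powr_mono2) auto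
      finally show "emeasure ?P (C w) \<le> ennreal (d powr s)"
        unfolding C_def cyl(2)[OF \<omega>w(1)] m_def by (rule ennreal_leI)
    qed
    show "\<exists>A\<in>sets ?P. G N \<inter> \<pi> -` U \<subseteq> A \<and> emeasure ?P A \<le> ennreal (4 * exp (\<theta> n) * d powr s)"
    proof (intro bexI[of _ "\<Union>w\<in>W. C w"] conjI)
      show "(\<Union>w\<in>W. C w) \<in> sets ?P" using W(1) C(1) by auto
      show "G N \<inter> \<pi> -` U \<subseteq> (\<Union>w\<in>W. C w)"
      proof
        fix \<beta> assume \<beta>: "\<beta> \<in> G N \<inter> \<pi> -` U"
        define w where "w = map \<beta> [0..<stop d \<beta>]"
        have w: "w \<in> W" using \<beta> by (auto simp: W_def w_def)
        have eq: "map \<beta> [0..<stop d \<beta>] = map (\<omega> w) [0..<stop d (\<omega> w)]" using \<omega>(2)[OF w] by (simp add: w_def)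
        then have len: "stop d \<beta> = stop d (\<omega> w)" by (metis length_map length_upt diff_zero)
        have "\<beta> k = \<omega> w k" if "k < stop d (\<omega> w)" for k
          using eq that by (simp add: len)
        then have "\<beta> \<in> C w" using G(1)[of \<beta> N] \<beta> by (simp add: C_def)
        then show "\<beta> \<in> (\<Union>w\<in>W. C w)" using w by blast
      qed
      have "emeasure ?P (\<Union>w\<in>W. C w) \<le> (\<Sum>w\<in>W. emeasure ?P (C w))"
        using W(1) C(1) by (intro emeasure_subadditive_finite) auto
      also have "\<dots> \<le> of_nat (card W) * ennreal (d powr s)"
        using C(2) by (rule sum_bounded_above)
      also have "\<dots> = ennreal (real (card W) * d powr s)"
        by (simp add: ennreal_mult ennreal_of_nat_eq_real_of_nat)
      also have "\<dots> \<le> ennreal (4 * exp (\<theta> n) * d powr s)"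
        using Wcard by (intro ennreal_leI mult_right_mono) auto
      finally show "emeasure ?P (\<Union>w\<in>W. C w) \<le> ennreal (4 * exp (\<theta> n) * d powr s)" .
    qed
  qed
  moreover have "hausdorff_measure s (\<pi> ` G N) = 0"
  proof (rule hausdorff_measure_eq_0_mono)
    \<comment> \<open>A two-set union written as a sequence, to fit the countable union
      lemma.\<close>
    define A where "A k = (if k = 0 then level_set a else boundary_points)" for k :: nat
    have "hausdorff_measure s (A k) = 0" for k
      using null hausdorff_measure_countable[OF countable_boundary_points] by (simp add: A_def)
    then show "hausdorff_measure s (\<Union>k. A k) = 0" by (rule hausdorff_measure_eq_0_UN)
    have "\<pi> \<omega> \<in> level_set a" if \<omega>: "\<omega> \<in> G N" and nb: "\<pi> \<omega> \<notin> boundary_points" for \<omega>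
    proof -
      note code = \<pi>_coding[OF G(2)[OF \<omega>] nb]
      have rep: "\<pi> \<omega> \<in> repeller n l u T" using code(1) by (auto simp: repeller_def)
      have "itinerary (\<pi> \<omega>) = \<omega>" using code(2) by (simp add: itinerary_def fun_eq_iff)
      then show ?thesis using level_set_iff[OF rep] G(3)[OF \<omega>] by simp
    qed
    moreover have "A 0 \<union> A 1 = level_set a \<union> boundary_points" by (simp add: A_def)
    ultimately show "\<pi> ` G N \<subseteq> (\<Union>k. A k)" by blast
  qed
  ultimately show False by contradiction
qed

lemma hausdorff_dim_level_set:
  assumes norm: "(\<Sum>i\<in>{1..n}. exp (t * \<theta> i - P)) = 1"
    and mean: "(\<Sum>i\<in>{1..n}. exp (t * \<theta> i - P) * \<theta> i) = a"
  shows "hausdorff_dim (level_set a) = ennreal (P / a - t)" "P / a - t \<ge> 0"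
proof -
  have "a > 0"
    unfolding mean[symmetric] using branches_nonempty by (intro sum_pos mult_pos_pos \<theta>_pos) auto
  \<comment> \<open>Every weight is at most 1, so \<open>t * \<theta> i \<le> P\<close>, and
    averaging gives the claim. Without it \<open>ennreal\<close> would truncate a negative
    \<open>P / a - t\<close> to 0.\<close>
  have "t * a \<le> P"
  proof -
    have "t * \<theta> i \<le> P" if "i \<in> {1..n}" for i
    proof -
      have "exp (t * \<theta> i - P) \<le> (\<Sum>i\<in>{1..n}. exp (t * \<theta> i - P))"
        using that by (intro member_le_sum) auto
      then show ?thesis using norm by simp
    qed
    then have "(\<Sum>i\<in>{1..n}. exp (t * \<theta> i - P) * (t * \<theta> i)) \<le> (\<Sum>i\<in>{1..n}. exp (t * \<theta> i - P) * P)"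
      by (intro sum_mono mult_left_mono) auto
    also have "\<dots> = P" by (simp only: sum_distrib_right[symmetric] norm mult_1)
    finally show ?thesis unfolding mean[symmetric] by (simp add: sum_distrib_left mult_ac)
  qed
  then show nonneg: "P / a - t \<ge> 0" using \<open>a > 0\<close> by (simp add: field_simps)
  show "hausdorff_dim (level_set a) = ennreal (P / a - t)"
  proof (rule antisym)
    show "hausdorff_dim (level_set a) \<le> ennreal (P / a - t)"
    proof (rule ennreal_le_epsilon)
      fix e :: real assume "e > 0"
      have "P / a - t + e > 0" "(P / a - t + e + t) * a > P"
        using nonneg \<open>e > 0\<close> \<open>a > 0\<close> by (auto simp: distrib_right)
      then have "hausdorff_measure (P / a - t + e) (level_set a) = 0"
        by (intro level_set_null[OF norm])
      then have "hausdorff_dim (level_set a) \<le> ennreal (P / a - t + e)"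
        unfolding hausdorff_dim_def using \<open>P / a - t + e > 0\<close> by (intro Inf_lower) blast
      then show "hausdorff_dim (level_set a) \<le> ennreal (P / a - t) + ennreal e"
        using nonneg \<open>e > 0\<close> by simp
    qed
    show "ennreal (P / a - t) \<le> hausdorff_dim (level_set a)"
      unfolding hausdorff_dim_def
    proof (rule Inf_greatest)
      fix d assume "d \<in> {ennreal s | s. 0 < s \<and> hausdorff_measure s (level_set a) = 0}"
      then obtain s where s: "d = ennreal s" "s > 0" "hausdorff_measure s (level_set a) = 0" by blast
      then have "\<not> (s + t) * a < P" using level_set_not_null[OF norm mean] by blast
      then have "P / a - t \<le> s" using \<open>a > 0\<close> by (simp add: field_simps)
      then show "ennreal (P / a - t) \<le> d" unfolding s(1) by (rule ennreal_leI)
    qed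
  qed
qed

lemma lyapunov_spectrum_eq:
  assumes "(\<Sum>i\<in>{1..n}. exp (t * \<theta> i - P)) = 1" "(\<Sum>i\<in>{1..n}. exp (t * \<theta> i - P) * \<theta> i) = a"
  shows "lyapunov_spectrum n l u br T a = P / a - t"
  using hausdorff_dim_level_set[OF assms] by (simp add: lyapunov_spectrum_def level_set_def)

lemma card_lyapunov_inflections:
  "finite (lyapunov_inflections n l u br T) \<and>
   real (card (lyapunov_inflections n l u br T)) \<le> real (essential_branch_number n l u) *
     (real (essential_branch_number n l u) - 1) * (real (essential_branch_number n l u) + 4) / 6"
proof -
  have n: "1 \<in> {1..n}" "n \<in> {1..n}" using branches_nonempty by auto
  have infl: "lyapunov_inflections n l u br T =
      {a \<in> {\<theta> 1<..<\<theta> n}. deriv (deriv (lyapunov_spectrum n l u br T)) a = 0}"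
    by (simp add: lyapunov_inflections_def \<theta>_def)
  have inj: "inj_on ln (slope l u ` {1..n})"
  proof (rule inj_onI)
    fix x y assume xy: "x \<in> slope l u ` {1..n}" "y \<in> slope l u ` {1..n}" "ln x = ln y"
    then have "0 < x" "0 < y" using expanding by fastforce+
    then show "x = y" using xy(3) by simp
  qed
  have "\<theta> ` {1..n} = ln ` slope l u ` {1..n}" by (simp add: \<theta>_def image_image)
  then have r: "essential_branch_number n l u = card (\<theta> ` {1..n})"
    using card_image[OF inj] by (simp add: essential_branch_number_def)
  show ?thesis
  proof (cases "\<theta> 1 = \<theta> n")
    \<comment> \<open>All slopes agree: the open interval is empty and the bound is 0 at
      \<open>r = 1\<close>.\<close>
    case True
    have "\<theta> i = \<theta> 1" if "i \<in> {1..n}" for i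
      using \<theta>_mono[of 1 i] \<theta>_mono[of i n] that n True by auto
    then have "\<theta> ` {1..n} = {\<theta> 1}" using n(1) by blast
    then show ?thesis using True r by (simp add: infl)
  next
    case False
    interpret exponential_sum "{1..n}" \<theta>
    proof unfold_locales
      show "\<exists>i\<in>{1..n}. \<exists>j\<in>{1..n}. \<theta> i \<noteq> \<theta> j" using False n by blast
    qed simp
    have pos: "\<alpha> t > 0" for t
    proof -
      have "\<theta> 1 \<le> \<alpha> t" by (rule \<alpha>_bounds[of _ "\<theta> n"]) (use n in \<open>auto intro: \<theta>_mono\<close>)
      then show ?thesis using \<theta>_pos[OF n(1)] by linarith
    qed
    have "lyapunov_spectrum n l u br T (\<alpha> t) = pressure t / \<alpha> t - t" for t
    proof (rule lyapunov_spectrum_eq)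
      have e: "exp (t * \<theta> i - pressure t) = exp (\<theta> i * t) / F 0 t" for i
        unfolding pressure_def exp_diff using F0_pos[of t] by (simp add: mult.commute)
      have F0: "(\<Sum>i\<in>{1..n}. exp (\<theta> i * t)) = F 0 t"
        by (simp only: F_def power_0 mult_1)
      show "(\<Sum>i\<in>{1..n}. exp (t * \<theta> i - pressure t)) = 1"
        unfolding e sum_divide_distrib[symmetric] F0 using F0_pos[of t] by simp
      show "(\<Sum>i\<in>{1..n}. exp (t * \<theta> i - pressure t) * \<theta> i) = \<alpha> t"
        unfolding e \<alpha>_def F_def[of 1] sum_divide_distrib by (simp add: mult.commute)
    qed
    moreover have "range \<alpha> = {\<theta> 1<..<\<theta> n}"
      by (rule range_\<alpha>) (use n in \<open>auto intro: \<theta>_mono\<close>)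
    ultimately show ?thesis
      using card_inflections[of "lyapunov_spectrum n l u br T", OF _ pos] by (simp add: infl r)
  qed
qed

end

lemma (in pl_expanding_map) ex_inverse_branches:
  "\<exists>\<phi>. pl_inverse_branches n l u br T \<phi>"
proof -
  have "\<exists>\<psi>. (\<exists>c d. \<bar>d\<bar> = 1 / slope l u i \<and> (\<forall>y. \<psi> y = c + d * y)) \<and> \<psi> ` {0..1} = {l i..u i} \<and>
      (\<forall>x\<in>pl_domain n l u. br x = i \<longrightarrow> \<psi> (T x) = x)" if i: "i \<in> {1..n}" for i
  proof -
    obtain c d where cd: "(\<lambda>x. c + d * x) ` {l i..u i} = {0..1}"
        "\<And>x. x \<in> pl_domain n l u \<Longrightarrow> br x = i \<Longrightarrow> T x = c + d * x"
      using affine_onto[OF i] by blast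
    have d: "\<bar>d\<bar> = slope l u i" by (rule abs_slope_affine[OF i cd(1)])
    then have d0: "d \<noteq> 0" using expanding[OF i] by auto
    \<comment> \<open>The affine formula, rather than an inverse of \<open>T\<close> on the
      interval, is defined even where \<open>br\<close> assigns an endpoint to another
      branch.\<close>
    define \<psi> where "\<psi> y = (y - c) / d" for y
    have \<psi>: "\<psi> (c + d * x) = x" for x using d0 by (simp add: \<psi>_def)
    have "\<psi> y = - c / d + 1 / d * y" for y by (simp add: \<psi>_def diff_divide_distrib)
    moreover have "\<bar>1 / d\<bar> = 1 / slope l u i" using d by simp
    moreover have "\<psi> ` {0..1} = {l i..u i}" unfolding cd(1)[symmetric] by (simp add: image_image \<psi>)
    ultimately have "\<exists>c d. \<bar>d\<bar> = 1 / slope l u i \<and> (\<forall>y. \<psi> y = c + d * y)" "\<psi> ` {0..1} = {l i..u i}"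
      by blast+
    then show ?thesis using cd(2) \<psi> by (intro exI[of _ \<psi>]) simp
  qed
  then obtain \<phi> where "\<And>i. i \<in> {1..n} \<Longrightarrow> (\<exists>c d. \<bar>d\<bar> = 1 / slope l u i \<and> (\<forall>y. \<phi> i y = c + d * y)) \<and>
      \<phi> i ` {0..1} = {l i..u i} \<and> (\<forall>x\<in>pl_domain n l u. br x = i \<longrightarrow> \<phi> i (T x) = x)"
    by metis
  then have "pl_inverse_branches n l u br T \<phi>"
    using branch by unfold_locales blast+
  then show ?thesis by blast
qed

theorem corollary4p4:
  fixes n :: nat and l u :: "nat \<Rightarrow> real" and br :: "real \<Rightarrow> nat" and T :: "real \<Rightarrow> real"
  assumes "pl_expanding_map n l u br T"
  shows "finite (lyapunov_inflections n l u br T) \<and>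
         (let r = real (essential_branch_number n l u)
          in real (card (lyapunov_inflections n l u br T)) \<le> r * (r - 1) * (r + 4) / 6)"
proof -
  obtain \<phi> where "pl_inverse_branches n l u br T \<phi>"
    using pl_expanding_map.ex_inverse_branches[OF assms] ..
  from pl_inverse_branches.card_lyapunov_inflections[OF this] show ?thesis
    by (simp add: Let_def)
qed

end
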